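(* Let $d\ge1$ and $\alpha\in(0,2)$. Let $f\in\mathscr{S}(\mathbb{R}^d)$ be real-valued and not identically zero, let $g=\partial_k f$ for some $k\in\{1,\ldots,d\}$, and let $\bar x\in\mathbb{R}^d$ be such that $g(\bar x)=\max_{x\in\mathbb{R}^d}g(x)$. Then: (i) for every $\delta\in(0,1)$, $$\Lambda^\alpha g(\bar x)\ \ge\ \frac{g(\bar x)^{1+\frac{\alpha}{1-\delta}}}{c\,\|f\|_{C^\delta}^{\frac{\alpha}{1-\delta}}},$$ where $c=c(d,\alpha,\delta)>0$ depends only on $d,\alpha,\delta$; (ii) for every $1\le p<\infty$, $$\Lambda^\alpha g(\bar x)\ \ge\ \frac{g(\bar x)^{1+\frac{\alpha p}{d+p}}}{c\,\|f\|_{L^p}^{\frac{\alpha p}{d+p}}},$$ where $c=c(d,\alpha,p)>0$ depends only on $d,\alpha,p$.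
   Context: $\mathscr{S}(\mathbb{R}^d)$ is the Schwartz class. $\Lambda=(-\Delta)^{1/2}$, and $\Lambda^\alpha$ is the Fourier multiplier $(\Lambda^\alpha g)^{\wedge}(\xi)=|\xi|^\alpha\hat g(\xi)$; for $0<\alpha<2$ it equals $\Lambda^\alpha g(x)=c_{d,\alpha}\,\mathrm{P.V.}\int_{\mathbb{R}^d}\frac{g(x)-g(x-y)}{|y|^{d+\alpha}}\,dy$ with a normalizing constant $c_{d,\alpha}>0$. $\|f\|_{C^\delta}=\|f\|_{L^\infty}+\sup_{x\ne y}\frac{|f(x)-f(y)|}{|x-y|^\delta}$ is the standard Hölder norm. *)

theory Defs
  imports "HOL-Probability.Probability" "HOL-Probability.Essential_Supremum"
begin

definition partial :: "'n::finite \<Rightarrow> (real^'n \<Rightarrow> real) \<Rightarrow> real^'n \<Rightarrow> real" where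
  "partial k f x = deriv (\<lambda>t. f (x + t *\<^sub>R axis k 1)) 0"

definition iter_partial :: "'n::finite list \<Rightarrow> (real^'n \<Rightarrow> real) \<Rightarrow> real^'n \<Rightarrow> real" where
  "iter_partial ks f = foldr partial ks f"

text \<open>Real-valued Schwartz functions. Derivative multi-indices are encoded as lists of
  coordinate directions. Differentiability of all iterated partial derivatives amounts to
  f being smooth; the second conjunct is finiteness of the seminorms
  \<open>sup\<^sub>x \<bar>x\<^sup>\<beta> \<partial>\<^sup>\<gamma> f(x)\<bar>\<close>.\<close>

definition schwartz :: "(real^'n::finite \<Rightarrow> real) \<Rightarrow> bool" where
  "schwartz f \<longleftrightarrow>
     (\<forall>ks. iter_partial ks f differentiable_on UNIV) \<and>
     (\<forall>ks (\<beta> :: 'n \<Rightarrow> nat).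
        bounded (range (\<lambda>x. (\<Prod>i\<in>UNIV. (x $ i) ^ \<beta> i) * iter_partial ks f x)))"

text \<open>The angular-frequency convention for the Fourier transform is the one for which the
  multiplier \<open>\<bar>\<xi>\<bar>\<close> is the symbol of \<open>(-\<Delta>)\<^sup>1\<^sup>/\<^sup>2\<close>.\<close>

definition fourier :: "(real^'n::finite \<Rightarrow> complex) \<Rightarrow> real^'n \<Rightarrow> complex" where
  "fourier h \<xi> = (LINT x|lborel. cis (- (x \<bullet> \<xi>)) * h x)"

definition inv_fourier :: "(real^'n::finite \<Rightarrow> complex) \<Rightarrow> real^'n \<Rightarrow> complex" where
  "inv_fourier h x =
     (LINT \<xi>|lborel. cis (x \<bullet> \<xi>) * h \<xi>) / complex_of_real ((2 * pi) ^ CARD('n))"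

text \<open>The operator is applied to real-valued functions only. There
  \<open>\<bar>\<xi>\<bar>\<^sup>\<alpha> (\<F> g)(\<xi>)\<close> is Hermitian-symmetric, so its inverse transform is real
  and the real part is just the conversion to type real.\<close>

definition Lambda :: "real \<Rightarrow> (real^'n::finite \<Rightarrow> real) \<Rightarrow> real^'n \<Rightarrow> real" where
  "Lambda \<alpha> g x =
     Re (inv_fourier
           (\<lambda>\<xi>. complex_of_real (norm \<xi> powr \<alpha>) * fourier (\<lambda>y. complex_of_real (g y)) \<xi>) x)"

definition Linf_norm :: "(real^'n::finite \<Rightarrow> real) \<Rightarrow> real" where
  "Linf_norm f = real_of_ereal (esssup lborel (\<lambda>x. ereal \<bar>f x\<bar>))"

definition Lp_norm :: "real \<Rightarrow> (real^'n::finite \<Rightarrow> real) \<Rightarrow> real" where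
  "Lp_norm p f = (LINT x|lborel. \<bar>f x\<bar> powr p) powr (1 / p)"

text \<open>The supremum and the norms above are real-valued and hence only meaningful when they
  are finite, as they are for Schwartz functions.\<close>

definition holder_norm :: "real \<Rightarrow> (real^'n::finite \<Rightarrow> real) \<Rightarrow> real" where
  "holder_norm \<delta> f =
     Linf_norm f + (SUP (x, y)\<in>{(x, y). x \<noteq> y}. \<bar>f x - f y\<bar> / norm (x - y) powr \<delta>)"

end

theory Submission
  imports Defs
begin

text \<open>The proof replaces the singular integral by Gaussian averages. Write \<open>\<phi>\<close> for the standard
  Gaussian density on \<open>\<real>\<^sup>d\<close> and \<open>m(s) = \<integral> \<phi>(z) g(x + s z) dz\<close>, which is the heat semigroup at time
  \<open>s\<^sup>2/2\<close> applied to \<open>g\<close>. For \<open>0 < \<alpha> < 2\<close> and \<open>r \<ge> 0\<close>, scaling gives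
  \<open>\<integral>\<^sub>0\<^sup>\<infinity> (1 - exp(- s\<^sup>2 r\<^sup>2 / 2)) s powr (- 1 - \<alpha>) ds = H r powr \<alpha>\<close> with a constant \<open>H > 0\<close> depending only on
  \<open>\<alpha>\<close> (lemma \<open>heat_scaling\<close>). Inserting this with \<open>r = \<bar>\<xi>\<bar>\<close> into the definition of \<open>\<Lambda>\<^sup>\<alpha> g(x)\<close> and exchanging
  the integrals turns the multiplier into
  \<open>H \<Lambda>\<^sup>\<alpha> g(x) = \<integral>\<^sub>0\<^sup>\<infinity> (g(x) - m(s)) s powr (- 1 - \<alpha>) ds\<close> (lemma \<open>Lambda_heat\<close>). The exchange needs that
  the Fourier transform of a Schwartz function decays rapidly (lemma \<open>rapid_fourier\<close>), and the
  identification of the inner integrals with \<open>g(x)\<close> and \<open>m(s)\<close> is Fourier inversion, which itself comes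
  from the Gaussian case by letting \<open>s \<rightarrow> 0\<close>.

  At a maximum of \<open>g\<close> with value \<open>M\<close> the integrand is nonnegative. If moreover \<open>\<bar>m(s)\<bar> \<le> A s powr (- \<gamma>)\<close>, then
  \<open>m(s) \<le> M/2\<close> for \<open>s \<ge> s\<^sub>0 = (2 A / M) powr (1 / \<gamma>)\<close>, and the integral over \<open>s \<ge> s\<^sub>0\<close> alone contributes
  \<open>(M / (2 \<alpha>)) s\<^sub>0 powr (- \<alpha>)\<close>, a constant times \<open>M powr (1 + \<alpha>/\<gamma>) / A powr (\<alpha>/\<gamma>)\<close>
  (lemma \<open>kern_lower_bound\<close>).

  It remains to bound \<open>m(s)\<close> when \<open>g = \<partial>\<^sub>k f\<close>. Moving the derivative onto the Gaussian gives
  \<open>m(s) = s\<^sup>-\<^sup>1 \<integral> z\<^sub>k \<phi>(z) (f(x + s z) - a) dz\<close> for every constant \<open>a\<close> (lemma \<open>gmean_partial\<close>). The choice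
  \<open>a = f(x)\<close> and Hoelder continuity give the exponent \<open>\<gamma> = 1 - \<delta>\<close>; the choice \<open>a = 0\<close> and
  integrability of \<open>\<bar>f\<bar> powr p\<close> give \<open>\<gamma> = 1 + d/p\<close>.\<close>

section \<open>Coordinatewise products and a polynomial weight\<close>

lemma lborel_vec_product:
  "(lborel :: (real^'n::finite) measure) =
     distr (\<Pi>\<^sub>M b\<in>Basis. (lborel :: real measure)) borel (\<lambda>f. \<Sum>b\<in>Basis. f b *\<^sub>R b)"
  unfolding lborel_def[where 'a="real^'n"] lborel_eq_real ..

lemma prod_Basis_vec:
  "(\<Prod>b\<in>(Basis :: (real^'n::finite) set). G b) = (\<Prod>i\<in>UNIV. G (axis i 1))"
proof -
  have "(Basis :: (real^'n) set) = (\<lambda>i. axis i 1) ` UNIV"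
    by (auto simp: Basis_vec_def)
  moreover have "inj (\<lambda>i::'n. axis i (1::real))"
    by (auto simp: inj_on_def axis_eq_axis)
  ultimately show ?thesis
    by (metis (no_types, lifting) prod.reindex comp_apply prod.cong)
qed

lemma
  fixes F :: "'n::finite \<Rightarrow> real \<Rightarrow> 'b::{real_normed_field,banach,second_countable_topology}"
  assumes F: "\<And>i. integrable lborel (F i)"
  shows integrable_prod_vec: "integrable lborel (\<lambda>x::real^'n. \<Prod>i\<in>UNIV. F i (x $ i))"
    and integral_prod_vec: "(\<integral>x. (\<Prod>i\<in>UNIV. F i ((x::real^'n) $ i)) \<partial>lborel) = (\<Prod>i\<in>UNIV. (\<integral>t. F i t \<partial>lborel))"
proof -
  interpret product_sigma_finite "\<lambda>_::real^'n. lborel :: real measure"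
    by standard
  \<comment> \<open>\<open>ix\<close> inverts \<open>i \<mapsto> axis i 1\<close>, so that the coordinates \<open>i\<close> can index the product over \<open>Basis\<close>\<close>
  define ix where "ix = (\<lambda>b::real^'n. SOME i. b = axis i 1)"
  have ix: "ix (axis i 1) = i" for i
    unfolding ix_def by (rule some_equality) (auto simp: axis_eq_axis)
  have meas: "(\<lambda>f. \<Sum>b\<in>Basis. f b *\<^sub>R b) \<in> measurable (\<Pi>\<^sub>M b\<in>(Basis::(real^'n) set). (lborel :: real measure)) borel"
    by measurable
  have FM[measurable]: "F i \<in> borel_measurable borel" for i
    using borel_measurable_integrable[OF F[of i]] by simp
  have M: "(\<lambda>x::real^'n. \<Prod>i\<in>UNIV. F i (x $ i)) \<in> borel_measurable borel"
    by measurable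
  have comp: "(\<Sum>b\<in>Basis. f b *\<^sub>R b) $ i = f (axis i 1)" for f and i :: 'n
  proof -
    have "(\<Sum>b\<in>Basis. f b *\<^sub>R b) $ i = (\<Sum>b\<in>Basis. f b *\<^sub>R b) \<bullet> (axis i 1 :: real^'n)"
      by (simp add: inner_axis)
    also have "\<dots> = f (axis i 1)"
      by (subst inner_sum_left_Basis) (auto simp: Basis_vec_def)
    finally show ?thesis .
  qed
  have eq: "(\<Prod>i\<in>UNIV. F i ((\<Sum>b\<in>Basis. f b *\<^sub>R b) $ i)) = (\<Prod>b\<in>Basis. F (ix b) (f b))" for f
    by (simp only: comp prod_Basis_vec ix)
  show "integrable lborel (\<lambda>x::real^'n. \<Prod>i\<in>UNIV. F i (x $ i))"
    unfolding lborel_vec_product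
    unfolding integrable_distr_eq[OF meas M] eq by (intro product_integrable_prod F finite_Basis)
  have "(\<integral>x. (\<Prod>i\<in>UNIV. F i ((x::real^'n) $ i)) \<partial>lborel) = (\<Prod>b\<in>(Basis :: (real^'n) set). (\<integral>t. F (ix b) t \<partial>lborel))"
    unfolding lborel_vec_product integral_distr[OF meas M] eq
    by (intro product_integral_prod F finite_Basis)
  then show "(\<integral>x. (\<Prod>i\<in>UNIV. F i ((x::real^'n) $ i)) \<partial>lborel) = (\<Prod>i\<in>UNIV. (\<integral>t. F i t \<partial>lborel))"
    by (simp only: prod_Basis_vec ix)
qed

text \<open>An integrable weight of polynomial decay. It is a product over the coordinates rather than a
  power of \<open>1 + \<bar>x\<bar>\<^sup>2\<close>, so that its integral factors into one-dimensional ones.\<close>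

definition weight :: "real^'n::finite \<Rightarrow> real" where
  "weight x = (\<Prod>i\<in>UNIV. inverse (1 + (x $ i)\<^sup>2))"

lemma one_plus_sq_pos: "0 < 1 + (x::real)\<^sup>2"
  by (simp add: add_pos_nonneg)

lemma inverse_weight: "inverse (weight x) = (\<Prod>i\<in>UNIV. 1 + (x $ i)\<^sup>2)"
  unfolding weight_def by (simp add: prod_inversef[symmetric] o_def)

lemma weight_pos: "0 < weight x"
  unfolding weight_def by (intro prod_pos) (simp add: one_plus_sq_pos)

lemma weight_le_1: "weight x \<le> 1"
  unfolding weight_def by (intro prod_le_1) (auto simp: one_plus_sq_pos less_imp_le inverse_le_1_iff)

lemma weight_measurable[measurable]: "weight \<in> borel_measurable borel"
  unfolding weight_def[abs_def] by measurable

lemma weight_integrable: "integrable lborel (weight :: real^'n::finite \<Rightarrow> real)"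
proof -
  have "integrable lborel (\<lambda>t::real. inverse (1 + t\<^sup>2))"
    using integrable_inverse_1_plus_square by (simp add: set_integrable_def)
  then show ?thesis
    unfolding weight_def[abs_def] by (rule integrable_prod_vec)
qed

text \<open>Up to a factor, the weight is insensitive to shifts of length at most one. This makes it a
  majorant for difference quotients of functions whose derivative it dominates.\<close>

lemma weight_shift:
  fixes x :: "real^'n::finite"
  assumes "\<bar>\<tau>\<bar> \<le> 1"
  shows "weight (x + \<tau> *\<^sub>R axis k 1) \<le> 3 * weight x"
proof -
  have one: "inverse (1 + (a + \<tau>)\<^sup>2) \<le> 3 * inverse (1 + a\<^sup>2)" for a :: real
  proof -
    \<comment> \<open>\<open>a = (a + \<tau>) - \<tau>\<close> and \<open>(u - v)\<^sup>2 \<le> 2 u\<^sup>2 + 2 v\<^sup>2\<close>\<close>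
    define b where "b = (a + \<tau>)\<^sup>2"
    have "a\<^sup>2 \<le> 2 * b + 2 * \<tau>\<^sup>2" unfolding b_def
      using zero_le_power2[of "a + 2 * \<tau>"] by (simp add: power2_eq_square algebra_simps)
    moreover have "\<tau>\<^sup>2 \<le> 1" using assms by (simp add: abs_square_le_1)
    moreover have "0 \<le> b" by (simp add: b_def)
    ultimately have "1 + a\<^sup>2 \<le> 3 * (1 + b)"
      by (smt (verit))
    then have "1 + a\<^sup>2 \<le> 3 * (1 + (a + \<tau>)\<^sup>2)" 
      by (simp add: b_def)
    then show ?thesis
      using one_plus_sq_pos[of a] one_plus_sq_pos[of "a+\<tau>"] by (simp add: field_simps)
  qed
  have rest: "(\<Prod>i\<in>UNIV - {k}. inverse (1 + ((x + \<tau> *\<^sub>R axis k 1) $ i)\<^sup>2)) = (\<Prod>i\<in>UNIV - {k}. inverse (1 + (x $ i)\<^sup>2))"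
    by (intro prod.cong) (auto simp: axis_def)
  have "weight (x + \<tau> *\<^sub>R axis k 1) = inverse (1 + (x $ k + \<tau>)\<^sup>2) * (\<Prod>i\<in>UNIV - {k}. inverse (1 + (x $ i)\<^sup>2))"
    unfolding weight_def using rest by (subst prod.remove[of _ k]) (simp_all add: axis_def)
  also have "\<dots> \<le> 3 * inverse (1 + (x $ k)\<^sup>2) * (\<Prod>i\<in>UNIV - {k}. inverse (1 + (x $ i)\<^sup>2))"
    by (intro mult_right_mono one prod_nonneg) (simp add: one_plus_sq_pos less_imp_le)
  also have "\<dots> = 3 * weight x"
    unfolding weight_def by (subst (2) prod.remove[of _ k]) simp_all
  finally show ?thesis .
qed

lemma norm_sq_le_weight:
  fixes x :: "real^'n::finite"
  shows "1 + (norm x)\<^sup>2 \<le> inverse (weight x)"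
proof -
  have "1 + sum (\<lambda>i. (x $ i)\<^sup>2) S \<le> (\<Prod>i\<in>S. 1 + (x $ i)\<^sup>2)" if "finite S" for S
    using that
  proof induction
    case (insert j S)
    have "1 + ((x $ j)\<^sup>2 + sum (\<lambda>i. (x $ i)\<^sup>2) S) \<le> (1 + (x $ j)\<^sup>2) * (1 + sum (\<lambda>i. (x $ i)\<^sup>2) S)"
      by (simp add: algebra_simps sum_nonneg)
    also have "\<dots> \<le> (1 + (x $ j)\<^sup>2) * (\<Prod>i\<in>S. 1 + (x $ i)\<^sup>2)"
      using insert by (intro mult_left_mono) (auto)
    finally show ?case using insert by simp
  qed simp
  from this[of UNIV] show ?thesis
    by (simp add: inverse_weight norm_vec_def L2_set_def sum_nonneg)
qed

lemma powr_le_one_plus_sq: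
  fixes r a :: real
  assumes "0 \<le> r" "0 \<le> a" "a \<le> 2"
  shows "r powr a \<le> 1 + r\<^sup>2"
proof (cases "r \<le> 1")
  case True
  then have "r powr a \<le> 1" using assms by (simp add: powr_le1)
  then show ?thesis by (smt (verit) zero_le_power2)
next
  case False
  then have "r powr a \<le> r powr 2" using assms by (intro powr_mono) auto
  also have "\<dots> = r\<^sup>2" using False by (subst powr_numeral) auto
  finally show ?thesis by simp
qed

lemma norm_powr_weight_le:
  fixes x :: "real^'n::finite"
  assumes "0 \<le> a" "a \<le> 2"
  shows "norm x powr a * weight x \<le> 1"
proof -
  have "norm x powr a \<le> 1 + (norm x)\<^sup>2"
    using assms by (intro powr_le_one_plus_sq) auto
  also have "\<dots> \<le> inverse (weight x)" by (rule norm_sq_le_weight)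
  finally show ?thesis using weight_pos[of x] by (simp add: field_simps)
qed

section \<open>Rapidly decreasing functions\<close>

text \<open>Decay faster than every polynomial: all products with a monomial are bounded. No smoothness
  is required, so that the notion applies to a Schwartz function and to its Fourier transform alike.\<close>

definition rapid :: "(real^'n::finite \<Rightarrow> 'b::real_normed_vector) \<Rightarrow> bool" where
  "rapid h \<longleftrightarrow> (\<forall>\<beta>::'n \<Rightarrow> nat. bounded (range (\<lambda>x. (\<Prod>i\<in>UNIV. (x $ i) ^ \<beta> i) *\<^sub>R h x)))"

lemma prod_power_Suc:
  fixes x :: "real^'n::finite"
  shows "(\<Prod>i\<in>UNIV. (x $ i) ^ (\<beta>(k := \<beta> k + m)) i) = (x $ k) ^ m * (\<Prod>i\<in>UNIV. (x $ i) ^ \<beta> i)"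
proof -
  have "(\<Prod>i\<in>UNIV - {k}. (x $ i) ^ (\<beta>(k := \<beta> k + m)) i) = (\<Prod>i\<in>UNIV - {k}. (x $ i) ^ \<beta> i)"
    by (intro prod.cong) auto
  then show ?thesis
    by (subst (1 2) prod.remove[of _ k]) (simp_all add: power_add)
qed

lemma rapid_mult_coord:
  assumes "rapid h" shows "rapid (\<lambda>x. (1 + (x $ k)\<^sup>2) *\<^sub>R h x)"
  unfolding rapid_def
proof
  fix \<beta> :: "'a \<Rightarrow> nat"
  have 1: "bounded (range (\<lambda>x. (\<Prod>i\<in>UNIV. (x $ i) ^ \<beta> i) *\<^sub>R h x))"
    and 2: "bounded (range (\<lambda>x. (\<Prod>i\<in>UNIV. (x $ i) ^ (\<beta>(k := \<beta> k + 2)) i) *\<^sub>R h x))"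
    using assms unfolding rapid_def by blast+
  from bounded_plus_comp[OF 1 2]
  show "bounded (range (\<lambda>x. (\<Prod>i\<in>UNIV. (x $ i) ^ \<beta> i) *\<^sub>R (1 + (x $ k)\<^sup>2) *\<^sub>R h x))"
    unfolding prod_power_Suc by (simp add: algebra_simps)
qed

lemma rapid_mult_inverse_weight:
  assumes "rapid h" shows "rapid (\<lambda>x. inverse (weight x) *\<^sub>R h x)"
proof -
  have "rapid (\<lambda>x. (\<Prod>i\<in>S. 1 + (x $ i)\<^sup>2) *\<^sub>R h x)" if "finite S" for S
    using that
  proof induction
    case empty then show ?case using assms by simp
  next
    case (insert j S)
    from rapid_mult_coord[OF insert(3), of j] insert(1,2) show ?case by simp
  qed
  from this[OF finite] show ?thesis by (simp only: inverse_weight)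
qed

text \<open>The square of the weight leaves one factor for integrability after the other has absorbed a
  growth of order at most two, such as that of \<open>\<bar>\<xi>\<bar> powr \<alpha>\<close>.\<close>

lemma rapid_bound:
  assumes "rapid h"
  obtains C where "0 < C" "\<And>x. norm (h x) \<le> C * weight x ^ 2"
proof -
  have "rapid (\<lambda>x. inverse (weight x) *\<^sub>R inverse (weight x) *\<^sub>R h x)"
    by (intro rapid_mult_inverse_weight assms)
  then have "bounded (range (\<lambda>x. (\<Prod>i\<in>UNIV. (x $ i) ^ 0) *\<^sub>R inverse (weight x) *\<^sub>R inverse (weight x) *\<^sub>R h x))"
    unfolding rapid_def by (rule spec[of _ "\<lambda>_. 0"])
  then have "bounded (range (\<lambda>x. inverse (weight x) *\<^sub>R inverse (weight x) *\<^sub>R h x))"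
    by simp
  then obtain C where C: "0 < C" "\<And>x. norm (inverse (weight x) *\<^sub>R inverse (weight x) *\<^sub>R h x) \<le> C"
    unfolding bounded_pos by auto
  have "norm (h x) \<le> C * weight x ^ 2" for x
    using C(2)[of x] weight_pos[of x] by (simp add: field_simps power2_eq_square)
  with C(1) show ?thesis by (rule that)
qed

lemma rapid_bound_weight:
  assumes "rapid h"
  obtains C where "0 < C" "\<And>x. norm (h x) \<le> C * weight x"
proof -
  from rapid_bound[OF assms] obtain C where C: "0 < C" "\<And>x. norm (h x) \<le> C * weight x ^ 2" by blast
  have "norm (h x) \<le> C * weight x" for x
  proof -
    have "weight x ^ 2 \<le> weight x"
      using weight_le_1[of x] weight_pos[of x] by (simp add: power2_eq_square mult_left_le)
    then show ?thesis using C(1) C(2)[of x] by (smt (verit) mult_left_mono)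
  qed
  with C(1) show ?thesis by (rule that)
qed

lemma rapid_integrable:
  fixes h :: "real^'n::finite \<Rightarrow> 'b::{banach,second_countable_topology}"
  assumes "rapid h" "h \<in> borel_measurable borel"
  shows "integrable lborel h"
proof -
  from rapid_bound_weight[OF assms(1)] obtain C where C: "0 < C" "\<And>x. norm (h x) \<le> C * weight x" by blast
  show ?thesis
    by (rule Bochner_Integration.integrable_bound[where f="\<lambda>x. C * weight x"])
       (use assms C weight_integrable in \<open>auto intro!: AE_I2 order.trans[OF C(2)] simp: weight_pos less_imp_le abs_mult\<close>)
qed

section \<open>Schwartz functions\<close>

lemma schwartz_partial: 
  assumes "schwartz f" shows "schwartz (partial k f)"
proof -
  have eq: "iter_partial ks (partial k f) = iter_partial (ks @ [k]) f" for ks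
    by (simp add: iter_partial_def)
  show ?thesis
    using assms unfolding schwartz_def eq by blast
qed

lemma schwartz_rapid: "schwartz f \<Longrightarrow> rapid f"
  unfolding schwartz_def rapid_def
  by (auto dest!: spec[of _ "[]"] simp: iter_partial_def)

lemma schwartz_differentiable: "schwartz f \<Longrightarrow> f differentiable_on UNIV"
  unfolding schwartz_def by (auto dest!: spec[of _ "[]"] simp: iter_partial_def)

lemma schwartz_continuous: "schwartz f \<Longrightarrow> continuous_on UNIV f"
  using schwartz_differentiable differentiable_imp_continuous_on by blast

lemma schwartz_measurable: "schwartz f \<Longrightarrow> f \<in> borel_measurable borel"
  by (intro borel_measurable_continuous_onI schwartz_continuous)

lemma schwartz_integrable: "schwartz f \<Longrightarrow> integrable lborel f"
  by (intro rapid_integrable schwartz_rapid schwartz_measurable)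

lemma schwartz_bound:
  assumes "schwartz f"
  obtains C where "0 < C" "\<And>x. \<bar>f x\<bar> \<le> C * weight x"
  using rapid_bound_weight[OF schwartz_rapid[OF assms]] by auto

lemma schwartz_bounded:
  assumes "schwartz f"
  obtains B where "0 < B" "\<And>x. \<bar>f x\<bar> \<le> B"
proof -
  obtain C where C: "0 < C" "\<And>x. \<bar>f x\<bar> \<le> C * weight x" using schwartz_bound[OF assms] by blast
  have "\<bar>f y\<bar> \<le> C" for y
    using C(1) C(2)[of y] weight_le_1[of y] by (smt (verit) mult_left_le)
  with C(1) show ?thesis by (rule that)
qed

lemma has_derivative_along_axis:
  assumes "(f has_derivative D) (at (x + t *\<^sub>R axis k 1))"
  shows "((\<lambda>t. f (x + t *\<^sub>R axis k 1)) has_real_derivative D (axis k 1)) (at t)"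
proof -
  have lin: "linear D" using assms by (rule has_derivative_linear)
  have "((\<lambda>t. f (x + t *\<^sub>R axis k 1)) has_derivative (\<lambda>h. D (h *\<^sub>R axis k 1))) (at t)"
    by (rule has_derivative_compose[of "\<lambda>t. x + t *\<^sub>R axis k 1" "\<lambda>h. h *\<^sub>R axis k 1" t UNIV f D])
       (auto intro!: derivative_eq_intros simp: assms)
  then show ?thesis
    unfolding has_field_derivative_def
    by (rule has_derivative_eq_rhs) (simp add: fun_eq_iff linear_scale[OF lin])
qed

lemma partial_eq_derivative:
  assumes "(f has_derivative D) (at y)"
  shows "partial k f y = D (axis k 1)"
  unfolding partial_def
  by (rule DERIV_imp_deriv, rule has_derivative_along_axis) (simp add: assms)

lemma differentiable_partial:
  assumes "f differentiable (at (x + t *\<^sub>R axis k 1))"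
  shows "((\<lambda>t. f (x + t *\<^sub>R axis k 1)) has_real_derivative partial k f (x + t *\<^sub>R axis k 1)) (at t)"
proof -
  from assms obtain D where D: "(f has_derivative D) (at (x + t *\<^sub>R axis k 1))"
    unfolding differentiable_def by blast
  show ?thesis
    using has_derivative_along_axis[OF D] by (simp only: partial_eq_derivative[OF D])
qed

lemma schwartz_has_partial:
  "schwartz f \<Longrightarrow> ((\<lambda>t. f (x + t *\<^sub>R axis k 1)) has_real_derivative partial k f (x + t *\<^sub>R axis k 1)) (at t)"
  using schwartz_differentiable[of f] by (intro differentiable_partial) (auto simp: differentiable_on_def)

section \<open>Integration by parts\<close>

lemma integral_shift:
  fixes F :: "'a::euclidean_space \<Rightarrow> 'b::{banach,second_countable_topology}"
  assumes "F \<in> borel_measurable borel"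
  shows "(\<integral>x. F (x + c) \<partial>lborel) = (\<integral>x. F x \<partial>lborel)"
proof -
  have "(\<integral>x. F x \<partial>lborel) = (\<integral>x. F x \<partial>(distr lborel borel ((+) c)))"
    by (simp add: lborel_distr_plus)
  also have "\<dots> = (\<integral>x. F (c + x) \<partial>lborel)"
    using assms by (subst integral_distr) auto
  finally show ?thesis by (simp add: add.commute)
qed

lemma integrable_shift:
  fixes F :: "'a::euclidean_space \<Rightarrow> 'b::{banach,second_countable_topology}"
  assumes "integrable lborel F"
  shows "integrable lborel (\<lambda>x. F (x + c))"
proof -
  have "integrable (distr lborel borel ((+) c)) F"
    using assms by (simp add: lborel_distr_plus)
  then show ?thesis
    using borel_measurable_integrable[OF assms] by (subst (asm) integrable_distr_eq) (auto simp: add.commute)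
qed

text \<open>The integral of a partial derivative over the whole space vanishes. By translation invariance
  every difference quotient has integral zero, and the quotients converge dominatedly.\<close>

lemma integral_partial_eq_0:
  fixes F F' :: "real^'n::finite \<Rightarrow> 'b::{banach,second_countable_topology}"
  assumes der: "\<And>x t. ((\<lambda>t. F (x + t *\<^sub>R axis k 1)) has_vector_derivative F' (x + t *\<^sub>R axis k 1)) (at t)"
    and F: "integrable lborel F"
    and F'[measurable]: "F' \<in> borel_measurable borel"
    and bound: "\<And>x. norm (F' x) \<le> C * weight x"
  shows "(\<integral>x. F' x \<partial>lborel) = 0"
proof -
  have FM[measurable]: "F \<in> borel_measurable borel"
    using borel_measurable_integrable[OF F] by simp
  define h where "h = (\<lambda>n. inverse (real (Suc n)))"
  have h: "0 < h n" "h n \<le> 1" for n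
    by (auto simp: h_def inverse_le_1_iff)
  have hlim: "h \<longlonglongrightarrow> 0"
    unfolding h_def by (rule LIMSEQ_inverse_real_of_nat)
  define Q where "Q = (\<lambda>n x. (F (x + h n *\<^sub>R axis k 1) - F x) /\<^sub>R h n)"
  have QM[measurable]: "Q n \<in> borel_measurable borel" for n
    unfolding Q_def by measurable
  have Qint: "(\<integral>x. Q n x \<partial>lborel) = 0" for n
  proof -
    have "(\<integral>x. Q n x \<partial>lborel) = ((\<integral>x. F (x + h n *\<^sub>R axis k 1) \<partial>lborel) - (\<integral>x. F x \<partial>lborel)) /\<^sub>R h n"
      unfolding Q_def by (simp add: Bochner_Integration.integral_diff integrable_shift F)
    also have "\<dots> = 0"
      by (simp add: integral_shift)
    finally show ?thesis .
  qed
  have Qlim: "(\<lambda>n. Q n x) \<longlonglongrightarrow> F' x" for x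
  proof -
    have "((\<lambda>t. F (x + t *\<^sub>R axis k 1)) has_vector_derivative F' x) (at 0)"
      using der[of x 0] by simp
    then have lim: "((\<lambda>t. norm (F (x + t *\<^sub>R axis k 1) - F x - t *\<^sub>R F' x) / norm t) \<longlongrightarrow> 0) (at 0)"
      unfolding has_vector_derivative_def has_derivative_at by simp
    have "((\<lambda>t. norm ((F (x + t *\<^sub>R axis k 1) - F x) /\<^sub>R t - F' x)) \<longlongrightarrow> 0) (at 0)"
    proof (rule Lim_transform_eventually[OF lim])
      have "norm (F (x + t *\<^sub>R axis k 1) - F x - t *\<^sub>R F' x) / norm t
          = norm ((F (x + t *\<^sub>R axis k 1) - F x) /\<^sub>R t - F' x)" if "t \<noteq> 0" for t
      proof -
        have "(F (x + t *\<^sub>R axis k 1) - F x) /\<^sub>R t - F' x = (F (x + t *\<^sub>R axis k 1) - F x - t *\<^sub>R F' x) /\<^sub>R t"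
          using that by (simp add: scaleR_diff_right)
        then show ?thesis by (simp add: divide_inverse mult.commute)
      qed
      then show "\<forall>\<^sub>F t in at 0. norm (F (x + t *\<^sub>R axis k 1) - F x - t *\<^sub>R F' x) / norm t
          = norm ((F (x + t *\<^sub>R axis k 1) - F x) /\<^sub>R t - F' x)"
        by (auto simp: eventually_at_filter)
    qed
    then have "((\<lambda>t. (F (x + t *\<^sub>R axis k 1) - F x) /\<^sub>R t) \<longlongrightarrow> F' x) (at 0)"
      by (rule LIM_zero_cancel[OF tendsto_norm_zero_cancel])
    moreover have "filterlim h (at 0) sequentially"
      unfolding filterlim_at using hlim h(1) by (auto simp: less_imp_neq[symmetric])
    ultimately show ?thesis
      unfolding Q_def by (rule filterlim_compose)
  qed
  have Qbound: "norm (Q n x) \<le> 3 * \<bar>C\<bar> * weight x" for n x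
  proof -
    have "norm (F (x + h n *\<^sub>R axis k 1) - F (x + 0 *\<^sub>R axis k 1)) \<le> (3 * \<bar>C\<bar> * weight x) * norm (h n - 0)"
    proof (rule differentiable_bound[where S="{0..h n}" and f'="\<lambda>t s. s *\<^sub>R F' (x + t *\<^sub>R axis k 1)"])
      fix t assume t: "t \<in> {0..h n}"
      show "((\<lambda>t. F (x + t *\<^sub>R axis k 1)) has_derivative (\<lambda>s. s *\<^sub>R F' (x + t *\<^sub>R axis k 1))) (at t within {0..h n})"
        using der[of x t] unfolding has_vector_derivative_def by (rule has_derivative_at_withinI)
      have "onorm (\<lambda>s::real. s *\<^sub>R F' (x + t *\<^sub>R axis k 1)) = norm (F' (x + t *\<^sub>R axis k 1))"
        by (subst onorm_scaleR_left) (auto simp: onorm_id)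
      also have "\<dots> \<le> \<bar>C\<bar> * weight (x + t *\<^sub>R axis k 1)"
        using bound by (rule order.trans) (simp add: mult_right_mono weight_pos less_imp_le)
      also have "\<dots> \<le> \<bar>C\<bar> * (3 * weight x)"
        using t h(2)[of n] by (intro mult_left_mono weight_shift) auto
      finally show "onorm (\<lambda>s::real. s *\<^sub>R F' (x + t *\<^sub>R axis k 1)) \<le> 3 * \<bar>C\<bar> * weight x"
        by simp
    qed (use h(1)[of n] in auto)
    moreover have "norm (Q n x) = norm (F (x + h n *\<^sub>R axis k 1) - F x) / h n"
      using h(1)[of n] by (simp add: Q_def divide_inverse mult.commute)
    ultimately show ?thesis
      using h(1)[of n] by (simp add: pos_divide_le_eq)
  qed
  have "(\<lambda>n. \<integral>x. Q n x \<partial>lborel) \<longlonglongrightarrow> (\<integral>x. F' x \<partial>lborel)"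
    by (rule integral_dominated_convergence[where w="\<lambda>x. 3 * \<bar>C\<bar> * weight x"])
       (auto simp: weight_integrable Qlim Qbound)
  then show ?thesis
    by (simp add: Qint LIMSEQ_const_iff)
qed

section \<open>The Fourier transform of a Schwartz function\<close>

lemma cis_has_vector_derivative:
  assumes "(\<theta> has_real_derivative d) (at t)"
  shows "((\<lambda>t. cis (\<theta> t)) has_vector_derivative (\<i> * of_real d * cis (\<theta> t))) (at t)"
proof -
  have eq: "cis = (\<lambda>x. complex_of_real (cos x) + \<i> * complex_of_real (sin x))"
    by (auto simp: complex_eq_iff)
  show ?thesis
    unfolding eq
    by (auto intro!: derivative_eq_intros assms) (simp add: complex_eq_iff algebra_simps)
qed

lemma continuous_on_cis[continuous_intros]:
  fixes f :: "'a::topological_space \<Rightarrow> real"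
  shows "continuous_on S f \<Longrightarrow> continuous_on S (\<lambda>x. cis (f x))"
  unfolding cis_conv_exp by (intro continuous_intros)

lemma cis_measurable[measurable]: "cis \<in> borel_measurable borel"
  by (intro borel_measurable_continuous_onI continuous_intros)

lemma integrable_cis_mult:
  fixes h :: "'a::euclidean_space \<Rightarrow> complex"
  assumes "integrable lborel h" and [measurable]: "\<theta> \<in> borel_measurable borel"
  shows "integrable lborel (\<lambda>x. cis (\<theta> x) * h x)"
proof (rule Bochner_Integration.integrable_bound[OF assms(1)])
  have [measurable]: "h \<in> borel_measurable borel"
    using borel_measurable_integrable[OF assms(1)] by simp
  show "(\<lambda>x. cis (\<theta> x) * h x) \<in> borel_measurable lborel"
    by measurable
qed (simp add: norm_mult)

lemma fourier_measurable[measurable]: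
  assumes [measurable]: "h \<in> borel_measurable borel"
  shows "fourier h \<in> borel_measurable borel"
proof -
  have "(\<lambda>\<xi>. \<integral>x. cis (- (x \<bullet> \<xi>)) * h x \<partial>lborel) \<in> borel_measurable (borel :: (real^'a) measure)"
    by (rule lborel.borel_measurable_lebesgue_integral) (simp add: split_beta')
  then show ?thesis by (simp add: fourier_def[abs_def])
qed

lemma norm_fourier_le: "norm (fourier h \<xi>) \<le> (\<integral>x. norm (h x) \<partial>lborel)"
  unfolding fourier_def
  by (rule order.trans[OF integral_norm_bound]) (simp add: norm_mult)

lemma fourier_partial:
  assumes g: "schwartz g"
  shows "fourier (\<lambda>y. complex_of_real (partial k g y)) \<xi> = \<i> * of_real (\<xi> $ k) * fourier (\<lambda>y. complex_of_real (g y)) \<xi>"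
proof -
  have g': "schwartz (partial k g)" using g by (rule schwartz_partial)
  note [measurable] = schwartz_measurable[OF g] schwartz_measurable[OF g']
  obtain C where C: "0 < C" "\<And>x. \<bar>g x\<bar> \<le> C * weight x" using schwartz_bound[OF g] by blast
  obtain C' where C': "0 < C'" "\<And>x. \<bar>partial k g x\<bar> \<le> C' * weight x" using schwartz_bound[OF g'] by blast
  define F where "F = (\<lambda>y. cis (- (y \<bullet> \<xi>)) * complex_of_real (g y))"
  define F' where "F' = (\<lambda>y. cis (- (y \<bullet> \<xi>)) * complex_of_real (partial k g y)
                 - \<i> * of_real (\<xi> $ k) * F y)"
  have F: "integrable lborel F" and F2: "integrable lborel (\<lambda>y. cis (- (y \<bullet> \<xi>)) * complex_of_real (partial k g y))"
    unfolding F_def using schwartz_integrable[OF g] schwartz_integrable[OF g']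
    by (intro integrable_cis_mult integrable_of_real; simp)+
  have "(\<integral>y. F' y \<partial>lborel) = 0"
  proof (rule integral_partial_eq_0[where k=k and F=F and C="C' + \<bar>\<xi> $ k\<bar> * C"])
    fix x t
    have "((\<lambda>t. - ((x + t *\<^sub>R axis k 1) \<bullet> \<xi>)) has_real_derivative - (\<xi> $ k)) (at t)"
      by (simp add: inner_add_left inner_axis' ) (auto intro!: derivative_eq_intros)
    note 1 = cis_has_vector_derivative[OF this] 
    note 2 = has_vector_derivative_of_real[OF schwartz_has_partial[OF g, of x k t], where 'a=complex]
    show "((\<lambda>t. F (x + t *\<^sub>R axis k 1)) has_vector_derivative F' (x + t *\<^sub>R axis k 1)) (at t)"
      unfolding F_def F'_def using has_vector_derivative_mult[OF 1 2]
      by (simp add: algebra_simps)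
  next
    fix x
    have "norm (F' x) \<le> \<bar>partial k g x\<bar> + \<bar>\<xi> $ k\<bar> * \<bar>g x\<bar>"
      unfolding F'_def F_def by (rule order.trans[OF norm_triangle_ineq4]) (simp add: norm_mult)
    also have "\<dots> \<le> C' * weight x + \<bar>\<xi> $ k\<bar> * (C * weight x)"
      by (intro add_mono C' mult_left_mono C) auto
    finally show "norm (F' x) \<le> (C' + \<bar>\<xi> $ k\<bar> * C) * weight x"
      by (simp add: algebra_simps)
  next
    show "F' \<in> borel_measurable borel" unfolding F'_def F_def by measurable
  qed (rule F)
  then show ?thesis
    unfolding F'_def using F F2 by (simp add: fourier_def F_def)
qed

text \<open>Each factor \<open>\<xi>\<^sub>k\<close> of a monomial is traded for a partial derivative of \<open>g\<close>, by induction on the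
  degree; what remains is the Fourier transform of a Schwartz function, which is bounded.\<close>

lemma rapid_fourier:
  assumes "schwartz g"
  shows "rapid (fourier (\<lambda>y. complex_of_real (g y)))"
  unfolding rapid_def
proof
  fix \<beta> :: "'a \<Rightarrow> nat"
  show "bounded (range (\<lambda>x. (\<Prod>i\<in>UNIV. (x $ i) ^ \<beta> i) *\<^sub>R fourier (\<lambda>y. complex_of_real (g y)) x))"
    using assms
  proof (induction "\<Sum>i\<in>UNIV. \<beta> i" arbitrary: \<beta> g)
    case 0
    then have "\<beta> i = 0" for i by simp
    moreover have "bounded (range (fourier (\<lambda>y. complex_of_real (g y))))"
      unfolding bounded_iff using norm_fourier_le by blast
    ultimately show ?case by simp
  next
    case (Suc m)
    have "\<exists>k. \<beta> k \<noteq> 0"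
      using Suc(2) by (rule contrapos_pp) simp
    then obtain k where k: "\<beta> k \<noteq> 0" ..
    define \<gamma> where "\<gamma> = \<beta>(k := \<beta> k - 1)"
    have \<beta>: "\<beta> = \<gamma>(k := \<gamma> k + 1)" using k by (auto simp: \<gamma>_def fun_eq_iff)
    have "(\<Sum>i\<in>UNIV - {k}. \<beta> i) = (\<Sum>i\<in>UNIV - {k}. \<gamma> i)"
      by (intro sum.cong) (auto simp: \<gamma>_def)
    then have "(\<Sum>i\<in>UNIV. \<beta> i) = Suc (\<Sum>i\<in>UNIV. \<gamma> i)"
      using k by (subst (1 2) sum.remove[of _ k]) (auto simp: \<gamma>_def)
    then have m: "m = (\<Sum>i\<in>UNIV. \<gamma> i)" using Suc(2) by simp
    have bd: "bounded (range (\<lambda>x. (\<Prod>i\<in>UNIV. (x $ i) ^ \<gamma> i) *\<^sub>R fourier (\<lambda>y. complex_of_real (partial k g y)) x))"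
      by (rule Suc(1)[OF m schwartz_partial[OF Suc(3)]])
    have "norm ((\<Prod>i\<in>UNIV. (x $ i) ^ \<beta> i) *\<^sub>R fourier (\<lambda>y. complex_of_real (g y)) x)
        = norm ((\<Prod>i\<in>UNIV. (x $ i) ^ \<gamma> i) *\<^sub>R fourier (\<lambda>y. complex_of_real (partial k g y)) x)" for x
      unfolding fourier_partial[OF Suc(3)] by (subst \<beta>, subst prod_power_Suc) (simp add: norm_mult abs_mult)
    with bd show ?case unfolding bounded_iff by auto
  qed
qed

lemma schwartz_fourier:
  assumes "schwartz g" "0 \<le> a" "a \<le> 2"
  shows "integrable lborel (\<lambda>\<xi>. complex_of_real (norm \<xi> powr a) * fourier (\<lambda>y. complex_of_real (g y)) \<xi>)"
    and "integrable lborel (fourier (\<lambda>y. complex_of_real (g y)))"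
proof -
  let ?G = "fourier (\<lambda>y. complex_of_real (g y))"
  note [measurable] = schwartz_measurable[OF assms(1)]
  obtain C where C: "0 < C" "\<And>x. norm (?G x) \<le> C * weight x ^ 2"
    using rapid_bound[OF rapid_fourier[OF assms(1)]] by blast
  have M[measurable]: "?G \<in> borel_measurable borel" by measurable
  show "integrable lborel ?G"
    by (intro rapid_integrable rapid_fourier assms M)
  show "integrable lborel (\<lambda>\<xi>. complex_of_real (norm \<xi> powr a) * ?G \<xi>)"
  proof (rule Bochner_Integration.integrable_bound[where f="\<lambda>x. C * weight x"])
    have "norm (norm \<xi> powr a * ?G \<xi>) \<le> C * weight \<xi>" for \<xi>
    proof -
      have "norm (norm \<xi> powr a * ?G \<xi>) \<le> norm \<xi> powr a * (C * weight \<xi> ^ 2)"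
        using C(2)[of \<xi>] by (simp add: norm_mult mult_left_mono)
      also have "\<dots> = C * weight \<xi> * (norm \<xi> powr a * weight \<xi>)" by (simp add: power2_eq_square)
      also have "\<dots> \<le> C * weight \<xi> * 1"
        using C(1) weight_pos[of \<xi>] by (intro mult_left_mono norm_powr_weight_le assms) auto
      finally show ?thesis by simp
    qed
    then show "AE \<xi> in lborel. norm (complex_of_real (norm \<xi> powr a) * ?G \<xi>) \<le> norm (C * weight \<xi>)"
      by (auto intro!: AE_I2 order.trans[OF _ abs_ge_self])
  qed (auto simp: weight_integrable)
qed

section \<open>The standard Gaussian density\<close>

text \<open>The density of the standard normal distribution on \<open>real^'n\<close>, as the product of its
  one-dimensional marginals.\<close>

definition gauss :: "real^'n::finite \<Rightarrow> real" where
  "gauss z = (\<Prod>i\<in>UNIV. std_normal_density (z $ i))"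

lemma gauss_pos: "0 < gauss z"
  unfolding gauss_def by (intro prod_pos) (simp add: normal_density_pos)

lemma gauss_measurable[measurable]: "gauss \<in> borel_measurable borel"
  unfolding gauss_def[abs_def] by measurable

lemma gauss_eq:
  fixes z :: "real^'n::finite"
  shows "gauss z = exp (- (norm z)\<^sup>2 / 2) / sqrt (2 * pi) ^ CARD('n)"
proof -
  have "(norm z)\<^sup>2 = (\<Sum>i\<in>UNIV. (z $ i)\<^sup>2)"
    by (simp add: norm_vec_def L2_set_def sum_nonneg)
  then have "exp (- (norm z)\<^sup>2 / 2) = (\<Prod>i\<in>UNIV. exp (- (z $ i)\<^sup>2 / 2))"
    by (simp add: exp_sum[symmetric] sum_negf sum_divide_distrib)
  then show ?thesis
    by (simp add: gauss_def std_normal_density_def prod_dividef prod.distrib)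
qed

lemma gauss_integrable: "integrable lborel (gauss :: real^'n::finite \<Rightarrow> real)"
  and gauss_integral: "(\<integral>z. gauss z \<partial>(lborel :: (real^'n::finite) measure)) = 1"
proof -
  have 1: "integrable lborel std_normal_density" "(\<integral>x. std_normal_density x \<partial>lborel) = 1"
    by auto
  show "integrable lborel (gauss :: real^'n::finite \<Rightarrow> real)"
    unfolding gauss_def[abs_def] by (intro integrable_prod_vec 1)
  show "(\<integral>z. gauss z \<partial>(lborel :: (real^'n::finite) measure)) = 1"
    unfolding gauss_def by (subst integral_prod_vec) (simp_all add: 1)
qed

text \<open>The characteristic function of the standard Gaussian, one coordinate at a time.\<close>

lemma gauss_char:
  fixes \<xi> :: "real^'n::finite"
  shows "(\<integral>z. cis (z \<bullet> \<xi>) * complex_of_real (gauss z) \<partial>lborel) = complex_of_real (exp (- (norm \<xi>)\<^sup>2 / 2))"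
proof -
  have one: "(\<integral>x. cis (x * t) * complex_of_real (std_normal_density x) \<partial>lborel) = complex_of_real (exp (- t\<^sup>2 / 2))" for t
  proof -
    have "complex_of_real (exp (- t\<^sup>2 / 2)) = char std_normal_distribution t"
      by (simp add: char_std_normal_distribution)
    also have "\<dots> = (\<integral>x. std_normal_density x *\<^sub>R iexp (t * x) \<partial>lborel)"
      unfolding char_def by (subst integral_density) auto
    finally show ?thesis
      by (simp add: cis_conv_exp scaleR_conv_of_real mult.commute mult.left_commute)
  qed
  have int: "integrable lborel (\<lambda>x. cis (x * t) * complex_of_real (std_normal_density x))" for t :: real
    by (intro integrable_cis_mult integrable_of_real) auto
  have prod: "cis (z \<bullet> \<xi>) * complex_of_real (gauss z) = (\<Prod>i\<in>UNIV. cis (z $ i * \<xi> $ i) * complex_of_real (std_normal_density (z $ i)))" for z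
    by (simp add: gauss_def inner_vec_def cis_conv_exp sum_distrib_left exp_sum prod.distrib)
  have nrm: "(norm \<xi>)\<^sup>2 = (\<Sum>i\<in>UNIV. (\<xi> $ i)\<^sup>2)"
    by (simp add: norm_vec_def L2_set_def sum_nonneg)
  show ?thesis
    unfolding prod
    by (subst integral_prod_vec[OF int], unfold one) 
       (simp add: nrm sum_negf[symmetric] sum_divide_distrib exp_sum )
qed

lemma gauss_weight_bound:
  obtains C where "0 < C" "\<And>z::real^'n::finite. gauss z \<le> C * weight z ^ 2"
proof
  show "0 < (8::real) ^ CARD('n)" by simp
  fix z :: "real^'n"
  \<comment> \<open>with \<open>v = x\<^sup>2 / 2\<close>, the bound \<open>(1 + 2 v)\<^sup>2 \<le> 8 (1 + v + v\<^sup>2 / 2) \<le> 8 exp v\<close>\<close>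
  have one: "std_normal_density x \<le> 8 * inverse (1 + x\<^sup>2) ^ 2" for x :: real
  proof -
    define v where "v = x\<^sup>2 / 2"
    have v: "0 \<le> v" by (simp add: v_def)
    have "(1 + x\<^sup>2) ^ 2 = (1 + 2 * v)\<^sup>2" by (simp add: v_def)
    also have "\<dots> \<le> 8 * (1 + v + v\<^sup>2 / 2)" using v by (simp add: power2_eq_square algebra_simps)
    also have "\<dots> \<le> 8 * exp v" using exp_lower_Taylor_quadratic[OF v] by simp
    finally have "(1 + x\<^sup>2) ^ 2 * exp (- v) \<le> 8" by (simp add: exp_minus field_simps)
    then have *: "exp (- v) \<le> 8 * inverse (1 + x\<^sup>2) ^ 2"
      using one_plus_sq_pos[of x] by (simp add: field_simps)
    have "1 \<le> sqrt (2 * pi)" using pi_gt3 by simp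
    then have "std_normal_density x \<le> exp (- v)"
      by (simp add: std_normal_density_def v_def divide_le_eq mult_le_cancel_left1 )
    with * show ?thesis by linarith
  qed
  have "gauss z \<le> (\<Prod>i\<in>UNIV. 8 * inverse (1 + (z $ i)\<^sup>2) ^ 2)"
    unfolding gauss_def by (intro prod_mono) (auto simp: one)
  also have "\<dots> = 8 ^ CARD('n) * weight z ^ 2"
    by (simp add: prod.distrib weight_def prod_power_distrib)
  finally show "gauss z \<le> 8 ^ CARD('n) * weight z ^ 2" .
qed

section \<open>Powers as superpositions of Gaussians\<close>

lemma has_bochner_integral_powr:
  fixes e I :: real
  assumes "((\<lambda>x. x powr e) has_integral I) S" "S \<in> sets borel"
  shows "has_bochner_integral lborel (\<lambda>x. indicator S x * x powr e) I"
proof (rule has_bochner_integral_nn_integral)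
  show "(\<integral>\<^sup>+ x. ennreal (indicator S x * x powr e) \<partial>lborel) = ennreal I"
  proof (rule nn_integral_has_integral_lborel)
    have "((\<lambda>x. if x \<in> S then x powr e else 0) has_integral I) UNIV"
      using assms(1) by (simp only: has_integral_restrict_UNIV)
    moreover have "(\<lambda>x. indicator S x * x powr e) = (\<lambda>x. if x \<in> S then x powr e else 0)"
      by auto
    ultimately show "((\<lambda>x. indicator S x * x powr e) has_integral I) UNIV"
      by simp
  qed (use assms(2) in simp_all)
  show "0 \<le> I"
    using has_integral_nonneg[OF assms(1)] by simp
  show "(\<lambda>x. indicator S x * x powr e) \<in> borel_measurable lborel"
    using assms(2) by simp
qed simp

lemma powr_tail:
  assumes "0 < (\<alpha>::real)" "0 < a"
  shows "has_bochner_integral lborel (\<lambda>s. indicator {a..} s * s powr (- 1 - \<alpha>)) (a powr (- \<alpha>) / \<alpha>)"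
  using has_bochner_integral_powr[OF has_integral_powr_to_inf[of "- 1 - \<alpha>" a]] assms by simp

text \<open>The measure \<open>s powr (- 1 - \<alpha>) ds\<close> on the positive half-line, as a density on the real line.\<close>

definition kern :: "real \<Rightarrow> real \<Rightarrow> real" where
  "kern \<alpha> s = indicator {0<..} s * s powr (- 1 - \<alpha>)"

lemma kern_nonneg: "0 \<le> kern \<alpha> s" by (simp add: kern_def)

lemma kern_measurable[measurable]: "kern \<alpha> \<in> borel_measurable borel"
  unfolding kern_def[abs_def] by measurable

text \<open>The normalizing constant \<open>H\<close> in \<open>\<integral>\<^sub>0\<^sup>\<infinity> (1 - exp(- s\<^sup>2 r\<^sup>2 / 2)) s powr (- 1 - \<alpha>) ds = H r powr \<alpha>\<close>, that is,
  the value of the integral at \<open>r = 1\<close>.\<close>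

definition heat_const :: "real \<Rightarrow> real" where
  "heat_const \<alpha> = (\<integral>s. kern \<alpha> s * (1 - exp (- s\<^sup>2 / 2)) \<partial>lborel)"

lemma one_minus_exp_bounds: "0 \<le> 1 - exp (- (s::real)\<^sup>2 / 2)" "1 - exp (- s\<^sup>2 / 2) \<le> 1" "1 - exp (- s\<^sup>2 / 2) \<le> s\<^sup>2"
proof -
  show "1 - exp (- s\<^sup>2 / 2) \<le> s\<^sup>2"
    using exp_ge_add_one_self[of "- s\<^sup>2 / 2"] zero_le_power2[of s] by linarith
qed auto

text \<open>Near zero the integrand is at most \<open>s powr (1 - \<alpha>)\<close>, integrable as \<open>\<alpha> < 2\<close>; near infinity it is at
  most \<open>s powr (- 1 - \<alpha>)\<close>, integrable as \<open>\<alpha> > 0\<close>.\<close>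

lemma heat_integrable:
  assumes "0 < \<alpha>" "\<alpha> < 2"
  shows "integrable lborel (\<lambda>s. kern \<alpha> s * (1 - exp (- s\<^sup>2 / 2)))"
proof (rule Bochner_Integration.integrable_bound)
  have 1: "integrable lborel (\<lambda>s. indicator {0..1} s * s powr (1 - \<alpha>))"
    using has_bochner_integral_powr[OF has_integral_powr_from_0[of "1 - \<alpha>" 1]] assms by (auto simp: has_bochner_integral_iff)
  show "integrable lborel (\<lambda>s. indicator {0..1} s * s powr (1 - \<alpha>) + indicator {1..} s * s powr (- 1 - \<alpha>))"
    using 1 powr_tail[OF assms(1), of 1] by (intro Bochner_Integration.integrable_add) (auto simp: has_bochner_integral_iff)
  show "AE s in lborel. norm (kern \<alpha> s * (1 - exp (- s\<^sup>2 / 2))) \<le> norm (indicator {0..1} s * s powr (1 - \<alpha>) + indicator {1..} s * s powr (- 1 - \<alpha>))"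
  proof (rule AE_I2)
    fix s :: real
    consider "s \<le> 0" | "0 < s" "s < 1" | "1 \<le> s" by linarith
    then show "norm (kern \<alpha> s * (1 - exp (- s\<^sup>2 / 2))) \<le> norm (indicator {0..1} s * s powr (1 - \<alpha>) + indicator {1..} s * s powr (- 1 - \<alpha>))"
    proof cases
      case 2
      have "s powr (- 1 - \<alpha>) * (1 - exp (- s\<^sup>2 / 2)) \<le> s powr (- 1 - \<alpha>) * s\<^sup>2"
        by (intro mult_left_mono one_minus_exp_bounds) auto
      also have "\<dots> = s powr (- 1 - \<alpha>) * s powr 2" using 2 by simp
      also have "\<dots> = s powr (1 - \<alpha>)" by (simp flip: powr_add)
      finally show ?thesis
        using 2 one_minus_exp_bounds(1)[of s] by (simp add: kern_def abs_mult)
    next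
      case 3
      have "s powr (- 1 - \<alpha>) * (1 - exp (- s\<^sup>2 / 2)) \<le> s powr (- 1 - \<alpha>) * 1"
        by (intro mult_left_mono one_minus_exp_bounds) auto
      then show ?thesis
        using 3 one_minus_exp_bounds(1)[of s] order.trans[OF _ exp_ge_zero, of "-1" "- (1/2)::real"]
        by (auto simp: kern_def abs_mult indicator_def)
    qed (simp add: kern_def)
  qed
qed measurable

lemma heat_const_pos:
  assumes "0 < \<alpha>" "\<alpha> < 2"
  shows "0 < heat_const \<alpha>"
proof -
  have "0 < (1 - exp (- (1/2::real))) * (1 powr (- \<alpha>) / \<alpha>)" using assms by simp
  also have "\<dots> = (\<integral>s. (1 - exp (- (1/2::real))) * (indicator {1..} s * s powr (- 1 - \<alpha>)) \<partial>lborel)"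
    using powr_tail[OF assms(1), of 1] by (simp add: has_bochner_integral_iff)
  also have "\<dots> \<le> heat_const \<alpha>"
    unfolding heat_const_def
  proof (rule integral_mono)
    show "integrable lborel (\<lambda>s. (1 - exp (- (1/2::real))) * (indicator {1..} s * s powr (- 1 - \<alpha>)))"
      using powr_tail[OF assms(1), of 1] by (simp add: has_bochner_integral_iff)
    show "integrable lborel (\<lambda>s. kern \<alpha> s * (1 - exp (- s\<^sup>2 / 2)))"
      by (rule heat_integrable[OF assms])
    fix s :: real
    show "(1 - exp (- (1/2::real))) * (indicator {1..} s * s powr (- 1 - \<alpha>)) \<le> kern \<alpha> s * (1 - exp (- s\<^sup>2 / 2))"
    proof (cases "1 \<le> s")
      case True
      then have "1 \<le> s\<^sup>2" by simp
      then have "exp (- s\<^sup>2 / 2) \<le> exp (- (1/2))" by simp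
      then have "s powr (- 1 - \<alpha>) * (1 - exp (- (1/2))) \<le> s powr (- 1 - \<alpha>) * (1 - exp (- s\<^sup>2 / 2))"
        by (intro mult_left_mono) auto
      then show ?thesis using True by (simp add: kern_def mult.commute)
    next
      case False
      then show ?thesis using kern_nonneg one_minus_exp_bounds(1) by simp
    qed
  qed
  finally show ?thesis .
qed

text \<open>The substitution \<open>u = r s\<close>. For \<open>r = 0\<close> both sides vanish, as \<open>0 powr \<alpha> = 0\<close>.\<close>

lemma heat_scaling:
  assumes "0 < \<alpha>" "\<alpha> < 2" "0 \<le> r"
  shows "integrable lborel (\<lambda>s. kern \<alpha> s * (1 - exp (- (s * r)\<^sup>2 / 2)))"
    and "(\<integral>s. kern \<alpha> s * (1 - exp (- (s * r)\<^sup>2 / 2)) \<partial>lborel) = heat_const \<alpha> * r powr \<alpha>"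
proof -
  let ?f = "\<lambda>s. kern \<alpha> s * (1 - exp (- s\<^sup>2 / 2))"
  have "integrable lborel (\<lambda>s. kern \<alpha> s * (1 - exp (- (s * r)\<^sup>2 / 2))) \<and>
    (\<integral>s. kern \<alpha> s * (1 - exp (- (s * r)\<^sup>2 / 2)) \<partial>lborel) = heat_const \<alpha> * r powr \<alpha>"
  proof (cases "r = 0")
    case False
    then have r: "0 < r" using assms by simp
    have eq: "kern \<alpha> s * (1 - exp (- (s * r)\<^sup>2 / 2)) = r powr (1 + \<alpha>) * ?f (0 + r * s)" for s
    proof (cases "0 < s")
      case True
      have "r powr (1 + \<alpha>) * (r * s) powr (- 1 - \<alpha>) = s powr (- 1 - \<alpha>)"
        using r True by (simp add: powr_mult powr_add[symmetric] flip: mult.assoc)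
      then show ?thesis using r True by (simp add: kern_def mult.commute)
    qed (use r in \<open>simp add: kern_def zero_less_mult_iff\<close>)
    have "integrable lborel (\<lambda>s. ?f (0 + r * s))"
      using r by (intro lborel_integrable_real_affine heat_integrable assms) auto
    moreover have "(\<integral>s. ?f (0 + r * s) \<partial>lborel) = heat_const \<alpha> / r"
      using lborel_integral_real_affine[of r ?f 0] r by (simp add: heat_const_def)
    moreover have "r powr (1 + \<alpha>) = r * r powr \<alpha>"
      using r by (simp add: powr_add)
    ultimately show ?thesis
      unfolding eq using r by simp
  qed simp
  then show "integrable lborel (\<lambda>s. kern \<alpha> s * (1 - exp (- (s * r)\<^sup>2 / 2)))"
    and "(\<integral>s. kern \<alpha> s * (1 - exp (- (s * r)\<^sup>2 / 2)) \<partial>lborel) = heat_const \<alpha> * r powr \<alpha>"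
    by blast+
qed

section \<open>Gaussian averages, Fourier inversion and the fractional Laplacian\<close>

lemma integral_affine:
  fixes f :: "'a::euclidean_space \<Rightarrow> 'b::{banach,second_countable_topology}"
  assumes [measurable]: "f \<in> borel_measurable borel" and c: "c \<noteq> 0"
  shows "(\<integral>x. f (t + c *\<^sub>R x) \<partial>lborel) = (\<integral>x. f x \<partial>lborel) /\<^sub>R \<bar>c\<bar> ^ DIM('a)"
proof -
  have "(\<integral>x. f x \<partial>lborel) = (\<integral>x. f x \<partial>(density (distr lborel borel (\<lambda>x. t + c *\<^sub>R x)) (\<lambda>_. ennreal (\<bar>c\<bar>^DIM('a)))))"
    using lborel_affine[OF c, of t] by (simp add: ennreal_power)
  also have "\<dots> = (\<integral>x. \<bar>c\<bar>^DIM('a) *\<^sub>R f x \<partial>distr lborel borel (\<lambda>x. t + c *\<^sub>R x))"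
    by (subst integral_density) auto
  also have "\<dots> = \<bar>c\<bar>^DIM('a) *\<^sub>R (\<integral>x. f (t + c *\<^sub>R x) \<partial>lborel)"
    by (subst integral_distr) auto
  finally show ?thesis using c by simp
qed

lemma integrable_affine:
  fixes f :: "'a::euclidean_space \<Rightarrow> 'b::{banach,second_countable_topology}"
  assumes f: "integrable lborel f" and c: "c \<noteq> 0"
  shows "integrable lborel (\<lambda>x. f (t + c *\<^sub>R x))"
proof -
  have [measurable]: "f \<in> borel_measurable borel" using borel_measurable_integrable[OF f] by simp
  have "integrable (density (distr lborel borel (\<lambda>x. t + c *\<^sub>R x)) (\<lambda>_. ennreal (\<bar>c\<bar>^DIM('a)))) f"
    using f lborel_affine[OF c, of t] by (simp add: ennreal_power)
  then have "integrable (distr lborel borel (\<lambda>x. t + c *\<^sub>R x)) (\<lambda>x. \<bar>c\<bar>^DIM('a) *\<^sub>R f x)"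
    by (subst (asm) integrable_density) auto
  from integrable_scaleR_right[OF this, of "inverse (\<bar>c\<bar>^DIM('a))"]
  have "integrable (distr lborel borel (\<lambda>x. t + c *\<^sub>R x)) f"
    using c by simp
  then show ?thesis by (subst (asm) integrable_distr_eq) auto
qed

lemma gauss_scale:
  fixes \<xi> :: "real^'n::finite"
  shows "exp (- (s * norm \<xi>)\<^sup>2 / 2) = sqrt (2 * pi) ^ CARD('n) * gauss (s *\<^sub>R \<xi>)"
  by (simp add: gauss_eq power_mult_distrib)

lemma gauss_scaled_char:
  fixes w :: "real^'n::finite"
  assumes s: "0 < s"
  shows "integrable lborel (\<lambda>\<xi>::real^'n. exp (- (s * norm \<xi>)\<^sup>2 / 2))"
    "(\<integral>\<xi>. cis (w \<bullet> \<xi>) * complex_of_real (exp (- (s * norm \<xi>)\<^sup>2 / 2)) \<partial>lborel)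
       = complex_of_real ((2 * pi) ^ CARD('n) * (gauss (w /\<^sub>R s) / s ^ CARD('n)))"
proof -
  show "integrable lborel (\<lambda>\<xi>::real^'n. exp (- (s * norm \<xi>)\<^sup>2 / 2))"
    unfolding gauss_scale using integrable_affine[OF gauss_integrable, of s 0] s by simp
  let ?H = "\<lambda>\<xi>. cis (\<xi> \<bullet> (w /\<^sub>R s)) * complex_of_real (gauss \<xi>)"
  have "(\<integral>\<xi>. cis (w \<bullet> \<xi>) * complex_of_real (exp (- (s * norm \<xi>)\<^sup>2 / 2)) \<partial>lborel)
     = (\<integral>\<xi>. complex_of_real (sqrt (2 * pi) ^ CARD('n)) * ?H (0 + s *\<^sub>R \<xi>) \<partial>lborel)"
  proof (rule Bochner_Integration.integral_cong[OF refl])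
    fix \<xi> :: "real^'n"
    have "(0 + s *\<^sub>R \<xi>) \<bullet> (w /\<^sub>R s) = w \<bullet> \<xi>"
      using s by (simp add: inner_commute)
    then show "cis (w \<bullet> \<xi>) * complex_of_real (exp (- (s * norm \<xi>)\<^sup>2 / 2))
      = complex_of_real (sqrt (2 * pi) ^ CARD('n)) * ?H (0 + s *\<^sub>R \<xi>)"
      unfolding gauss_scale by simp
  qed
  also have "\<dots> = complex_of_real (sqrt (2 * pi) ^ CARD('n)) * ((\<integral>\<xi>. ?H \<xi> \<partial>lborel) /\<^sub>R \<bar>s\<bar> ^ CARD('n))"
    using s by (subst integral_mult_right_zero, subst integral_affine) auto
  also have "(\<integral>\<xi>. ?H \<xi> \<partial>lborel) = complex_of_real (exp (- (norm (w /\<^sub>R s))\<^sup>2 / 2))"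
    by (rule gauss_char)
  also have "exp (- (norm (w /\<^sub>R s))\<^sup>2 / 2) = sqrt (2 * pi) ^ CARD('n) * gauss (w /\<^sub>R s)"
    using gauss_scale[of 1 "w /\<^sub>R s"] by simp
  also have "complex_of_real (sqrt (2 * pi) ^ CARD('n)) * (complex_of_real (sqrt (2 * pi) ^ CARD('n) * gauss (w /\<^sub>R s)) /\<^sub>R \<bar>s\<bar> ^ CARD('n))
     = complex_of_real ((sqrt (2 * pi) * sqrt (2 * pi)) ^ CARD('n) * (gauss (w /\<^sub>R s) / s ^ CARD('n)))"
    unfolding power_mult_distrib using s by (simp add: scaleR_conv_of_real divide_inverse)
  finally show "(\<integral>\<xi>. cis (w \<bullet> \<xi>) * complex_of_real (exp (- (s * norm \<xi>)\<^sup>2 / 2)) \<partial>lborel)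
       = complex_of_real ((2 * pi) ^ CARD('n) * (gauss (w /\<^sub>R s) / s ^ CARD('n)))"
    by simp
qed

text \<open>The average of \<open>g\<close> around \<open>x\<close> against the centred Gaussian of standard deviation \<open>s\<close> in each
  coordinate.\<close>

definition gmean :: "(real^'n::finite \<Rightarrow> real) \<Rightarrow> real^'n \<Rightarrow> real \<Rightarrow> real" where
  "gmean g x s = (\<integral>z. gauss z * g (x + s *\<^sub>R z) \<partial>lborel)"

text \<open>Damping the Fourier transform by a Gaussian and inverting it yields the Gaussian average. The
  damping factor makes the double integral absolutely convergent, so that the \<open>\<xi>\<close>-integral can be
  evaluated first, where it is the characteristic function of a Gaussian.\<close>

lemma fourier_gauss:
  fixes g :: "real^'n::finite \<Rightarrow> real"
  assumes g: "schwartz g" and s: "0 < s"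
  shows "(\<integral>\<xi>. cis (x \<bullet> \<xi>) * complex_of_real (exp (- (s * norm \<xi>)\<^sup>2 / 2)) * fourier (\<lambda>y. complex_of_real (g y)) \<xi> \<partial>lborel)
      = complex_of_real ((2 * pi) ^ CARD('n) * gmean g x s)"
proof -
  note [measurable] = schwartz_measurable[OF g]
  let ?e = "\<lambda>\<xi>::real^'n. exp (- (s * norm \<xi>)\<^sup>2 / 2)"
  define H where "H = (\<lambda>\<xi> y. cis ((x - y) \<bullet> \<xi>) * complex_of_real (?e \<xi>) * complex_of_real (g y))"
  have Hint: "integrable (lborel \<Otimes>\<^sub>M lborel) (case_prod H)"
  proof (rule lborel_pair.Fubini_integrable)
    show "case_prod H \<in> borel_measurable (lborel \<Otimes>\<^sub>M lborel)"
      unfolding H_def split_beta' by measurable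
    have nrm: "norm (H \<xi> y) = ?e \<xi> * norm (g y)" for \<xi> y
      by (simp add: H_def norm_mult)
    show "integrable lborel (\<lambda>\<xi>. \<integral>y. norm (case_prod H (\<xi>, y)) \<partial>lborel)"
      unfolding prod.case nrm integral_mult_right_zero
      by (intro integrable_mult_left gauss_scaled_char(1)[OF s])
    have "integrable lborel (\<lambda>y. H \<xi> y)" for \<xi>
      unfolding H_def mult.assoc
      by (intro integrable_cis_mult integrable_mult_right integrable_of_real schwartz_integrable g) measurable
    then show "AE \<xi> in lborel. integrable lborel (\<lambda>y. case_prod H (\<xi>, y))" by simp
  qed
  have "(\<integral>\<xi>. cis (x \<bullet> \<xi>) * complex_of_real (?e \<xi>) * fourier (\<lambda>y. complex_of_real (g y)) \<xi> \<partial>lborel)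
     = (\<integral>\<xi>. (\<integral>y. H \<xi> y \<partial>lborel) \<partial>lborel)"
  proof (rule Bochner_Integration.integral_cong[OF refl])
    fix \<xi>
    have "H \<xi> y = (cis (x \<bullet> \<xi>) * complex_of_real (?e \<xi>)) * (cis (- (y \<bullet> \<xi>)) * complex_of_real (g y))" for y
    proof -
      have "cis ((x - y) \<bullet> \<xi>) = cis (x \<bullet> \<xi>) * cis (- (y \<bullet> \<xi>))"
        by (simp add: cis_mult inner_diff_left)
      then show ?thesis by (simp add: H_def)
    qed
    then show "cis (x \<bullet> \<xi>) * complex_of_real (?e \<xi>) * fourier (\<lambda>y. complex_of_real (g y)) \<xi> = (\<integral>y. H \<xi> y \<partial>lborel)"
      by (simp add: fourier_def)
  qed
  also have "\<dots> = (\<integral>y. (\<integral>\<xi>. H \<xi> y \<partial>lborel) \<partial>lborel)"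
    by (rule lborel_pair.Fubini_integral[OF Hint, symmetric])
  also have "\<dots> = (\<integral>y. complex_of_real ((2 * pi) ^ CARD('n) / s ^ CARD('n) * (gauss ((x - y) /\<^sub>R s) * g y)) \<partial>lborel)"
  proof (rule Bochner_Integration.integral_cong[OF refl])
    fix y
    have "(\<integral>\<xi>. H \<xi> y \<partial>lborel) = complex_of_real ((2 * pi) ^ CARD('n) * (gauss ((x - y) /\<^sub>R s) / s ^ CARD('n))) * complex_of_real (g y)"
      unfolding H_def integral_mult_left_zero gauss_scaled_char(2)[OF s] ..
    then show "(\<integral>\<xi>. H \<xi> y \<partial>lborel) = complex_of_real ((2 * pi) ^ CARD('n) / s ^ CARD('n) * (gauss ((x - y) /\<^sub>R s) * g y))"
      by simp
  qed
  also have "\<dots> = complex_of_real ((2 * pi) ^ CARD('n) / s ^ CARD('n) * (\<integral>y. gauss ((x - y) /\<^sub>R s) * g y \<partial>lborel))"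
    by (simp only: integral_complex_of_real integral_mult_right_zero)
  also have "(\<integral>y. gauss ((x - y) /\<^sub>R s) * g y \<partial>lborel) = s ^ CARD('n) * gmean g x s"
  proof -
    have "gmean g x s = (\<integral>z. gauss ((x - (x + s *\<^sub>R z)) /\<^sub>R s) * g (x + s *\<^sub>R z) \<partial>lborel)"
      unfolding gmean_def using s by (simp add: gauss_eq)
    also have "\<dots> = (\<integral>y. gauss ((x - y) /\<^sub>R s) * g y \<partial>lborel) /\<^sub>R \<bar>s\<bar> ^ CARD('n)"
      using s by (subst integral_affine[where f="\<lambda>y. gauss ((x - y) /\<^sub>R s) * g y"]) auto
    finally show ?thesis using s by simp
  qed
  finally show ?thesis using s by simp
qed

lemma gmean_tendsto:
  fixes g :: "real^'n::finite \<Rightarrow> real"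
  assumes g: "schwartz g"
  shows "(\<lambda>n. gmean g x (inverse (real (Suc n)))) \<longlonglongrightarrow> g x"
proof -
  note [measurable] = schwartz_measurable[OF g]
  obtain C where C: "0 < C" "\<And>x. \<bar>g x\<bar> \<le> C" using schwartz_bounded[OF g] by blast
  have "(\<lambda>n. \<integral>z. gauss z * g (x + inverse (real (Suc n)) *\<^sub>R z) \<partial>lborel) \<longlonglongrightarrow> (\<integral>z. gauss (z::real^'n) * g x \<partial>lborel)"
  proof (rule integral_dominated_convergence[where w="\<lambda>z::real^'n. gauss z * C"])
    show "integrable lborel (\<lambda>z::real^'n. gauss z * C)" by (intro integrable_mult_left gauss_integrable)
    show "AE z in lborel. (\<lambda>n. gauss z * g (x + inverse (real (Suc n)) *\<^sub>R z)) \<longlonglongrightarrow> gauss z * g x"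
    proof (rule AE_I2)
      fix z :: "real^'n"
      have "(\<lambda>n. x + inverse (real (Suc n)) *\<^sub>R z) \<longlonglongrightarrow> x + 0 *\<^sub>R z"
        by (intro tendsto_intros LIMSEQ_inverse_real_of_nat)
      moreover have "isCont g x"
        using schwartz_continuous[OF g] by (simp add: continuous_on_eq_continuous_at)
      ultimately have "(\<lambda>n. g (x + inverse (real (Suc n)) *\<^sub>R z)) \<longlonglongrightarrow> g x"
        using isCont_tendsto_compose[of x g] by simp
      then show "(\<lambda>n. gauss z * g (x + inverse (real (Suc n)) *\<^sub>R z)) \<longlonglongrightarrow> gauss z * g x"
        by (rule tendsto_mult_left)
    qed
    show "AE z in lborel. norm (gauss z * g (x + inverse (real (Suc n)) *\<^sub>R z)) \<le> gauss z * C" for n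
      using C(2) by (auto simp: abs_mult gauss_pos less_imp_le intro!: mult_left_mono)
  qed measurable
  then show ?thesis by (simp only: gmean_def integral_mult_left_zero gauss_integral mult_1_left)
qed

text \<open>The limit of the preceding identity as the damping is removed.\<close>

lemma fourier_inversion:
  fixes g :: "real^'n::finite \<Rightarrow> real"
  assumes g: "schwartz g"
  shows "(\<integral>\<xi>. cis (x \<bullet> \<xi>) * fourier (\<lambda>y. complex_of_real (g y)) \<xi> \<partial>lborel)
      = complex_of_real ((2 * pi) ^ CARD('n) * g x)"
proof -
  let ?G = "fourier (\<lambda>y. complex_of_real (g y))"
  note [measurable] = schwartz_measurable[OF g]
  have G: "integrable lborel ?G" using schwartz_fourier(2)[OF g, of 0] by simp
  define s where "s = (\<lambda>n. inverse (real (Suc n)))"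
  have s: "0 < s n" for n by (simp add: s_def)
  have "(\<lambda>n. \<integral>\<xi>. cis (x \<bullet> \<xi>) * complex_of_real (exp (- (s n * norm \<xi>)\<^sup>2 / 2)) * ?G \<xi> \<partial>lborel)
      \<longlonglongrightarrow> (\<integral>\<xi>. cis (x \<bullet> \<xi>) * ?G \<xi> \<partial>lborel)"
  proof (rule integral_dominated_convergence[where w="\<lambda>\<xi>. norm (?G \<xi>)"])
    show "integrable lborel (\<lambda>\<xi>. norm (?G \<xi>))" using G by simp
    show "AE \<xi> in lborel. (\<lambda>n. cis (x \<bullet> \<xi>) * complex_of_real (exp (- (s n * norm \<xi>)\<^sup>2 / 2)) * ?G \<xi>) \<longlonglongrightarrow> cis (x \<bullet> \<xi>) * ?G \<xi>"
    proof (rule AE_I2)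
      fix \<xi> :: "real^'n"
      have "(\<lambda>n. cis (x \<bullet> \<xi>) * complex_of_real (exp (- (s n * norm \<xi>)\<^sup>2 / 2)) * ?G \<xi>) \<longlonglongrightarrow> cis (x \<bullet> \<xi>) * complex_of_real (exp (- (0 * norm \<xi>)\<^sup>2 / 2)) * ?G \<xi>"
        unfolding s_def by (intro tendsto_intros LIMSEQ_inverse_real_of_nat) simp
      then show "(\<lambda>n. cis (x \<bullet> \<xi>) * complex_of_real (exp (- (s n * norm \<xi>)\<^sup>2 / 2)) * ?G \<xi>) \<longlonglongrightarrow> cis (x \<bullet> \<xi>) * ?G \<xi>" by simp
    qed
    show "AE \<xi> in lborel. norm (cis (x \<bullet> \<xi>) * complex_of_real (exp (- (s n * norm \<xi>)\<^sup>2 / 2)) * ?G \<xi>) \<le> norm (?G \<xi>)" for n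
      by (auto simp: norm_mult mult_left_le_one_le)
  qed measurable
  moreover have "(\<lambda>n. \<integral>\<xi>. cis (x \<bullet> \<xi>) * complex_of_real (exp (- (s n * norm \<xi>)\<^sup>2 / 2)) * ?G \<xi> \<partial>lborel)
      \<longlonglongrightarrow> complex_of_real ((2 * pi) ^ CARD('n) * g x)"
    unfolding fourier_gauss[OF g s] unfolding s_def
    by (intro tendsto_of_real tendsto_mult_left gmean_tendsto g)
  ultimately show ?thesis by (rule LIMSEQ_unique)
qed

text \<open>The fractional Laplacian as a superposition of the defects \<open>g(x) - m(s)\<close>. Integrating first in \<open>s\<close>
  gives the multiplier \<open>\<bar>\<xi>\<bar> powr \<alpha>\<close>; integrating first in \<open>\<xi>\<close> gives the defect.\<close>

lemma Lambda_heat: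
  fixes g :: "real^'n::finite \<Rightarrow> real"
  assumes g: "schwartz g" and \<alpha>: "0 < \<alpha>" "\<alpha> < 2"
  shows "integrable lborel (\<lambda>s. kern \<alpha> s * (g x - gmean g x s))"
    and "heat_const \<alpha> * Lambda \<alpha> g x = (\<integral>s. kern \<alpha> s * (g x - gmean g x s) \<partial>lborel)"
proof -
  let ?G = "fourier (\<lambda>y. complex_of_real (g y))"
  note [measurable] = schwartz_measurable[OF g]
  have G: "integrable lborel ?G" using schwartz_fourier(2)[OF g, of 0] by simp
  have GA: "integrable lborel (\<lambda>\<xi>. complex_of_real (norm \<xi> powr \<alpha>) * ?G \<xi>)"
    using schwartz_fourier(1)[OF g, of \<alpha>] \<alpha> by simp
  define P where "P = ((2 * pi) ^ CARD('n) :: real)"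
  have P: "P \<noteq> 0" by (simp add: P_def)
  define k where "k = (\<lambda>s (\<xi>::real^'n). kern \<alpha> s * (1 - exp (- (s * norm \<xi>)\<^sup>2 / 2)))"
  have k_nonneg: "0 \<le> k s \<xi>" for s \<xi>
    unfolding k_def by (intro mult_nonneg_nonneg kern_nonneg one_minus_exp_bounds)
  have k_int: "integrable lborel (\<lambda>s. k s \<xi>)" and k_eq: "(\<integral>s. k s \<xi> \<partial>lborel) = heat_const \<alpha> * norm \<xi> powr \<alpha>" for \<xi>
    unfolding k_def using heat_scaling[OF \<alpha>, of "norm \<xi>"] by auto
  define H where "H = (\<lambda>\<xi> s. complex_of_real (k s \<xi>) * (cis (x \<bullet> \<xi>) * ?G \<xi>))"
  have Hint: "integrable (lborel \<Otimes>\<^sub>M lborel) (case_prod H)"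
  proof (rule lborel_pair.Fubini_integrable)
    show "case_prod H \<in> borel_measurable (lborel \<Otimes>\<^sub>M lborel)"
      unfolding H_def split_beta' k_def by measurable
    have nrm: "norm (H \<xi> s) = k s \<xi> * norm (?G \<xi>)" for \<xi> s
      using k_nonneg by (simp add: H_def norm_mult)
    have "(\<integral>s. norm (H \<xi> s) \<partial>lborel) = heat_const \<alpha> * norm (complex_of_real (norm \<xi> powr \<alpha>) * ?G \<xi>)" for \<xi>
      unfolding nrm by (simp add: k_eq norm_mult)
    then show "integrable lborel (\<lambda>\<xi>. \<integral>s. norm (case_prod H (\<xi>, s)) \<partial>lborel)"
      using GA by simp
    have "integrable lborel (\<lambda>s. H \<xi> s)" for \<xi>
      unfolding H_def by (intro integrable_mult_left integrable_of_real k_int)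
    then show "AE \<xi> in lborel. integrable lborel (\<lambda>s. case_prod H (\<xi>, s))" by simp
  qed
  have inner1: "(\<integral>s. H \<xi> s \<partial>lborel) = heat_const \<alpha> * (cis (x \<bullet> \<xi>) * (complex_of_real (norm \<xi> powr \<alpha>) * ?G \<xi>))" for \<xi>
  proof -
    have "(\<integral>s. H \<xi> s \<partial>lborel) = complex_of_real (\<integral>s. k s \<xi> \<partial>lborel) * (cis (x \<bullet> \<xi>) * ?G \<xi>)"
      unfolding H_def by (subst integral_mult_left_zero, subst integral_complex_of_real) simp
    then show ?thesis by (simp add: k_eq)
  qed
  have inner2: "(\<integral>\<xi>. H \<xi> s \<partial>lborel) = complex_of_real (P * (kern \<alpha> s * (g x - gmean g x s)))" for s
  proof (cases "0 < s")
    case True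
    have i1: "integrable lborel (\<lambda>\<xi>. cis (x \<bullet> \<xi>) * ?G \<xi>)"
      by (intro integrable_cis_mult G) measurable
    have i2: "integrable lborel (\<lambda>\<xi>. cis (x \<bullet> \<xi>) * complex_of_real (exp (- (s * norm \<xi>)\<^sup>2 / 2)) * ?G \<xi>)"
      by (rule Bochner_Integration.integrable_bound[OF G])
         (auto simp: norm_mult mult_left_le_one_le)
    have "(\<integral>\<xi>. H \<xi> s \<partial>lborel) = (\<integral>\<xi>. complex_of_real (kern \<alpha> s) * (cis (x \<bullet> \<xi>) * ?G \<xi> - cis (x \<bullet> \<xi>) * complex_of_real (exp (- (s * norm \<xi>)\<^sup>2 / 2)) * ?G \<xi>) \<partial>lborel)"
      by (intro Bochner_Integration.integral_cong) (simp_all add: H_def k_def algebra_simps)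
    also have "\<dots> = complex_of_real (kern \<alpha> s) * (complex_of_real (P * g x) - complex_of_real (P * gmean g x s))"
      unfolding P_def by (subst integral_mult_right_zero, subst Bochner_Integration.integral_diff[OF i1 i2], 
          subst fourier_inversion[OF g], subst fourier_gauss[OF g True]) simp
    finally show ?thesis by (simp add: algebra_simps)
  qed (simp add: H_def k_def kern_def)
  have "integrable lborel (\<lambda>s. \<integral>\<xi>. H \<xi> s \<partial>lborel)"
    by (rule lborel_pair.integrable_snd[OF Hint])
  then have "integrable lborel (\<lambda>s. P * (kern \<alpha> s * (g x - gmean g x s)))"
    unfolding inner2 by (simp only: complex_of_real_integrable_eq)
  then show int: "integrable lborel (\<lambda>s. kern \<alpha> s * (g x - gmean g x s))"
    using P by simp
  have "complex_of_real (P * (\<integral>s. kern \<alpha> s * (g x - gmean g x s) \<partial>lborel)) = (\<integral>s. (\<integral>\<xi>. H \<xi> s \<partial>lborel) \<partial>lborel)"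
    unfolding inner2 by (simp only: integral_complex_of_real integral_mult_right_zero)
  also have "\<dots> = (\<integral>\<xi>. (\<integral>s. H \<xi> s \<partial>lborel) \<partial>lborel)"
    by (rule lborel_pair.Fubini_integral[OF Hint])
  also have "\<dots> = heat_const \<alpha> * (\<integral>\<xi>. cis (x \<bullet> \<xi>) * (complex_of_real (norm \<xi> powr \<alpha>) * ?G \<xi>) \<partial>lborel)"
    unfolding inner1 by (rule integral_mult_right_zero)
  finally have eq: "complex_of_real (P * (\<integral>s. kern \<alpha> s * (g x - gmean g x s) \<partial>lborel))
    = heat_const \<alpha> * (\<integral>\<xi>. cis (x \<bullet> \<xi>) * (complex_of_real (norm \<xi> powr \<alpha>) * ?G \<xi>) \<partial>lborel)" .
  define J where "J = (\<integral>\<xi>. cis (x \<bullet> \<xi>) * (complex_of_real (norm \<xi> powr \<alpha>) * ?G \<xi>) \<partial>lborel)"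
  define I where "I = (\<integral>s. kern \<alpha> s * (g x - gmean g x s) \<partial>lborel)"
  have "Lambda \<alpha> g x = Re J / P"
    unfolding Lambda_def inv_fourier_def J_def P_def by (simp only: Re_divide_of_real)
  moreover have "P * I = heat_const \<alpha> * Re J"
    using arg_cong[OF eq, of Re] unfolding J_def[symmetric] I_def[symmetric] by simp
  ultimately have "P * (heat_const \<alpha> * Lambda \<alpha> g x) = P * I"
    using P by simp
  then have "heat_const \<alpha> * Lambda \<alpha> g x = I"
    using P by simp
  then show "heat_const \<alpha> * Lambda \<alpha> g x = (\<integral>s. kern \<alpha> s * (g x - gmean g x s) \<partial>lborel)"
    by (simp only: I_def)
qed

section \<open>Gaussian averages of a partial derivative\<close>

lemma gauss_moment_bound:
  obtains C where "0 < C" "\<And>z::real^'n::finite. (1 + (norm z)\<^sup>2) * gauss z \<le> C * weight z"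
proof -
  obtain C where C: "0 < C" "\<And>z::real^'n. gauss z \<le> C * weight z ^ 2"
    using gauss_weight_bound by blast
  have "(1 + (norm z)\<^sup>2) * gauss z \<le> C * weight z" for z :: "real^'n"
  proof -
    have "(1 + (norm z)\<^sup>2) * gauss z \<le> inverse (weight z) * (C * weight z ^ 2)"
      using gauss_pos[of z] weight_pos[of z] by (intro mult_mono norm_sq_le_weight C) auto
    also have "\<dots> = C * weight z"
      using weight_pos[of z] by (simp add: power2_eq_square)
    finally show ?thesis .
  qed
  with C(1) show ?thesis by (rule that)
qed

lemma gauss_moment_integrable:
  assumes "\<And>z::real^'n::finite. \<bar>h z\<bar> \<le> B * (1 + (norm z)\<^sup>2)" "h \<in> borel_measurable borel"
  shows "integrable lborel (\<lambda>z::real^'n. h z * gauss z)"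
proof -
  obtain C where C: "0 < C" "\<And>z::real^'n. (1 + (norm z)\<^sup>2) * gauss z \<le> C * weight z"
    using gauss_moment_bound by blast
  have B: "0 \<le> B" using assms(1)[of 0] by simp
  show ?thesis
  proof (rule Bochner_Integration.integrable_bound[where f="\<lambda>z. B * (C * weight z)"])
    show "integrable lborel (\<lambda>z::real^'n. B * (C * weight z))"
      by (intro integrable_mult_right weight_integrable)
    show "(\<lambda>z. h z * gauss z) \<in> borel_measurable lborel" using assms(2) by simp
    show "AE z in lborel. norm (h z * gauss z) \<le> norm (B * (C * weight z))"
    proof (rule AE_I2)
      fix z :: "real^'n"
      have "norm (h z * gauss z) \<le> B * (1 + (norm z)\<^sup>2) * gauss z"
        using assms(1)[of z] gauss_pos[of z] by (simp add: abs_mult)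
      also have "\<dots> \<le> B * (C * weight z)"
        using mult_left_mono[OF C(2)[of z] B] by (simp add: mult.assoc)
      finally show "norm (h z * gauss z) \<le> norm (B * (C * weight z))" by simp
    qed
  qed
qed

lemma norm_le_one_plus_sq: "norm z \<le> 1 + (norm z)\<^sup>2"
  using zero_le_power2[of "norm z - 1/2"] by (simp add: power2_eq_square algebra_simps)

lemma gauss_has_partial:
  "((\<lambda>t. gauss (z + t *\<^sub>R axis k 1)) has_real_derivative - ((z + t *\<^sub>R axis k 1) $ k) * gauss (z + t *\<^sub>R axis k 1)) (at t)"
proof -
  have nrm: "(norm (z + t *\<^sub>R axis k 1))\<^sup>2 = (norm z)\<^sup>2 + 2 * t * (z $ k) + t\<^sup>2" for t
    unfolding power2_norm_eq_inner
    by (simp add: inner_add_left inner_add_right inner_axis inner_axis' power2_eq_square algebra_simps)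
  show ?thesis
    unfolding gauss_eq nrm
    by (auto intro!: derivative_eq_intros) (simp add: axis_def field_simps)
qed

text \<open>Gaussian integration by parts. Subtracting a constant \<open>a\<close> from \<open>f\<close> does not change its partial
  derivative, which leaves \<open>a\<close> free to be chosen in each estimate.\<close>

lemma gmean_partial:
  fixes f :: "real^'n::finite \<Rightarrow> real"
  assumes f: "schwartz f" and s: "0 < s"
  shows "integrable lborel (\<lambda>z. z $ k * (f (x + s *\<^sub>R z) - a) * gauss z)"
    and "gmean (partial k f) x s = (\<integral>z. z $ k * (f (x + s *\<^sub>R z) - a) * gauss z \<partial>lborel) / s"
proof -
  have f': "schwartz (partial k f)" using f by (rule schwartz_partial)
  note [measurable] = schwartz_measurable[OF f] schwartz_measurable[OF f']
  obtain B where B: "0 < B" "\<And>x. \<bar>f x\<bar> \<le> B" using schwartz_bounded[OF f] by blast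
  obtain B' where B': "0 < B'" "\<And>x. \<bar>partial k f x\<bar> \<le> B'" using schwartz_bounded[OF f'] by blast
  have fa: "\<bar>f y - a\<bar> \<le> B + \<bar>a\<bar>" for y using B(2)[of y] by linarith
  have z1: "\<bar>z $ k * (f (x + s *\<^sub>R z) - a)\<bar> \<le> (B + \<bar>a\<bar>) * (1 + (norm z)\<^sup>2)" for z
  proof -
    have "\<bar>z $ k\<bar> \<le> 1 + (norm z)\<^sup>2"
      using component_le_norm_cart[of z k] norm_le_one_plus_sq[of z] by linarith
    then show ?thesis
      unfolding abs_mult using fa[of "x + s *\<^sub>R z"] by (subst mult.commute) (intro mult_mono, auto)
  qed
  have one: "(1::real) \<le> 1 + (norm z)\<^sup>2" for z :: "real^'n" by simp
  have z2: "\<bar>s * partial k f (x + s *\<^sub>R z)\<bar> \<le> (s * B') * (1 + (norm z)\<^sup>2)" for z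
    unfolding abs_mult using mult_mono[OF mult_left_mono[OF B'(2)[of "x + s *\<^sub>R z"], of s] one[of z]] s B'(1) by simp
  have z3: "\<bar>f (x + s *\<^sub>R z) - a\<bar> \<le> (B + \<bar>a\<bar>) * (1 + (norm z)\<^sup>2)" for z
    using mult_mono[OF fa[of "x + s *\<^sub>R z"] one[of z]] B(1) by simp
  have i1: "integrable lborel (\<lambda>z. z $ k * (f (x + s *\<^sub>R z) - a) * gauss z)"
    by (rule gauss_moment_integrable[OF z1]) measurable
  have i2: "integrable lborel (\<lambda>z. s * partial k f (x + s *\<^sub>R z) * gauss z)"
    by (rule gauss_moment_integrable[OF z2]) measurable
  have i3: "integrable lborel (\<lambda>z. (f (x + s *\<^sub>R z) - a) * gauss z)"
    by (rule gauss_moment_integrable[OF z3]) measurable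
  obtain C where C: "0 < C" "\<And>z::real^'n. (1 + (norm z)\<^sup>2) * gauss z \<le> C * weight z"
    using gauss_moment_bound by blast
  \<comment> \<open>the \<open>k\<close>-th partial derivative of \<open>(f(x + s z) - a) \<phi>(z)\<close> in \<open>z\<close>\<close>
  define F' where "F' = (\<lambda>z. s * partial k f (x + s *\<^sub>R z) * gauss z - z $ k * (f (x + s *\<^sub>R z) - a) * gauss z)"
  have "(\<integral>z. F' z \<partial>lborel) = 0"
  proof (rule integral_partial_eq_0[OF _ i3, where k=k and C="(s * B' + (B + \<bar>a\<bar>)) * C"])
    fix z t
    have 1: "((\<lambda>t. f ((x + s *\<^sub>R z) + (s * t) *\<^sub>R axis k 1)) has_real_derivative
         partial k f ((x + s *\<^sub>R z) + (s * t) *\<^sub>R axis k 1) * s) (at t)"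
      by (rule DERIV_chain2[OF schwartz_has_partial[OF f]]) (auto intro!: derivative_eq_intros)
    have eq: "x + s *\<^sub>R (z + t *\<^sub>R axis k 1) = (x + s *\<^sub>R z) + (s * t) *\<^sub>R axis k 1" for t
      by (simp add: algebra_simps)
    show "((\<lambda>t. (f (x + s *\<^sub>R (z + t *\<^sub>R axis k 1)) - a) * gauss (z + t *\<^sub>R axis k 1)) has_vector_derivative F' (z + t *\<^sub>R axis k 1)) (at t)"
      unfolding F'_def eq has_real_derivative_iff_has_vector_derivative[symmetric]
      by (rule DERIV_cong[OF DERIV_mult[OF DERIV_diff[OF 1 DERIV_const] gauss_has_partial]])
         (simp add: algebra_simps del: vector_add_component vector_scaleR_component)
  next
    fix z
    have "norm (F' z) \<le> \<bar>s * partial k f (x + s *\<^sub>R z) * gauss z\<bar> + \<bar>z $ k * (f (x + s *\<^sub>R z) - a) * gauss z\<bar>"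
      unfolding F'_def real_norm_def by (rule abs_triangle_ineq4)
    also have "\<dots> = \<bar>s * partial k f (x + s *\<^sub>R z)\<bar> * gauss z + \<bar>z $ k * (f (x + s *\<^sub>R z) - a)\<bar> * gauss z"
      by (simp only: abs_mult abs_of_pos[OF gauss_pos])
    also have "\<dots> \<le> (s * B') * (1 + (norm z)\<^sup>2) * gauss z + (B + \<bar>a\<bar>) * (1 + (norm z)\<^sup>2) * gauss z"
      using gauss_pos[of z] by (intro add_mono mult_right_mono z1 z2) auto
    also have "\<dots> = (s * B' + (B + \<bar>a\<bar>)) * ((1 + (norm z)\<^sup>2) * gauss z)"
      by (simp add: algebra_simps)
    also have "\<dots> \<le> (s * B' + (B + \<bar>a\<bar>)) * (C * weight z)"
      using s B B' by (intro mult_left_mono C) auto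
    finally show "norm (F' z) \<le> (s * B' + (B + \<bar>a\<bar>)) * C * weight z" by simp
  next
    show "F' \<in> borel_measurable borel" unfolding F'_def by measurable
  qed
  then have "(\<integral>z. s * partial k f (x + s *\<^sub>R z) * gauss z \<partial>lborel) = (\<integral>z. z $ k * (f (x + s *\<^sub>R z) - a) * gauss z \<partial>lborel)"
    unfolding F'_def Bochner_Integration.integral_diff[OF i2 i1] by simp
  moreover have "(\<integral>z. s * partial k f (x + s *\<^sub>R z) * gauss z \<partial>lborel) = s * gmean (partial k f) x s"
    unfolding gmean_def integral_mult_right_zero[symmetric] by (intro Bochner_Integration.integral_cong) simp_all
  ultimately show "gmean (partial k f) x s = (\<integral>z. z $ k * (f (x + s *\<^sub>R z) - a) * gauss z \<partial>lborel) / s"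
    using s by (simp add: field_simps)
  show "integrable lborel (\<lambda>z. z $ k * (f (x + s *\<^sub>R z) - a) * gauss z)" by (rule i1)
qed

lemma gmean_partial_bound:
  fixes f :: "real^'n::finite \<Rightarrow> real"
  assumes f: "schwartz f" and s: "0 < s"
    and h: "integrable lborel h" "\<And>z. norm z * \<bar>f (x + s *\<^sub>R z) - a\<bar> * gauss z \<le> h z"
  shows "\<bar>gmean (partial k f) x s\<bar> \<le> (\<integral>z. h z \<partial>lborel) / s"
proof -
  have "\<bar>\<integral>z. z $ k * (f (x + s *\<^sub>R z) - a) * gauss z \<partial>lborel\<bar> \<le> (\<integral>z. h z \<partial>lborel)"
  proof (rule order.trans[OF integral_abs_bound], rule integral_mono)
    show "integrable lborel (\<lambda>z. \<bar>z $ k * (f (x + s *\<^sub>R z) - a) * gauss z\<bar>)"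
      using gmean_partial(1)[OF f s] by (rule integrable_abs)
    fix z :: "real^'n"
    have "\<bar>z $ k * (f (x + s *\<^sub>R z) - a) * gauss z\<bar> = \<bar>z $ k\<bar> * \<bar>f (x + s *\<^sub>R z) - a\<bar> * gauss z"
      using gauss_pos[of z] by (simp add: abs_mult)
    also have "\<dots> \<le> norm z * \<bar>f (x + s *\<^sub>R z) - a\<bar> * gauss z"
      using gauss_pos[of z] by (intro mult_right_mono component_le_norm_cart) auto
    finally show "\<bar>z $ k * (f (x + s *\<^sub>R z) - a) * gauss z\<bar> \<le> h z" using h(2)[of z] by linarith
  qed (rule h)
  then show ?thesis
    unfolding gmean_partial(2)[OF f s, of k x a] using s by (simp add: divide_right_mono)
qed

lemma gmean_le:
  fixes g :: "real^'n::finite \<Rightarrow> real"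
  assumes g: "schwartz g" and M: "\<And>y. g y \<le> M"
  shows "gmean g x s \<le> M"
proof -
  note [measurable] = schwartz_measurable[OF g]
  obtain B where B: "0 < B" "\<And>x. \<bar>g x\<bar> \<le> B" using schwartz_bounded[OF g] by blast
  have "\<bar>g (x + s *\<^sub>R z)\<bar> \<le> B * (1 + (norm z)\<^sup>2)" for z
    using mult_mono[OF B(2)[of "x + s *\<^sub>R z"], of 1 "1 + (norm z)\<^sup>2"] B(1) by simp
  then have "integrable lborel (\<lambda>z. g (x + s *\<^sub>R z) * gauss z)"
    by (rule gauss_moment_integrable) measurable
  then have "gmean g x s \<le> (\<integral>z. gauss (z::real^'n) * M \<partial>lborel)"
    unfolding gmean_def using M gauss_pos
    by (intro integral_mono integrable_mult_left gauss_integrable mult_left_mono) (auto simp: mult.commute less_imp_le[OF gauss_pos])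
  then show ?thesis by (simp only: integral_mult_left_zero gauss_integral mult_1_left)
qed

section \<open>The lower bound at a maximum\<close>

text \<open>The quantitative core, separated from the function spaces: a bound on the averages \<open>m(s)\<close> that
  decays in \<open>s\<close> forces a lower bound on the weighted integral of the defects \<open>M - m(s)\<close>.\<close>

lemma kern_lower_bound:
  assumes \<alpha>: "0 < \<alpha>" and \<gamma>: "0 < \<gamma>" and A: "0 < A"
    and int: "integrable lborel (\<lambda>s. kern \<alpha> s * (M - m s))"
    and mM: "\<And>s. 0 < s \<Longrightarrow> m s \<le> M"
    and mA: "\<And>s. 0 < s \<Longrightarrow> \<bar>m s\<bar> \<le> A * s powr (- \<gamma>)"
  shows "M powr (1 + \<alpha> / \<gamma>) / (2 * \<alpha> * (2 * A) powr (\<alpha> / \<gamma>)) \<le> (\<integral>s. kern \<alpha> s * (M - m s) \<partial>lborel)"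
proof -
  have nonneg: "0 \<le> kern \<alpha> s * (M - m s)" for s
    using mM[of s] by (cases "0 < s") (simp_all add: kern_def)
  \<comment> \<open>\<open>M\<close> dominates averages that tend to zero as \<open>s \<rightarrow> \<infinity>\<close>\<close>
  have M0: "0 \<le> M"
  proof (rule tendsto_lowerbound)
    have "((\<lambda>s. M + A * s powr (- \<gamma>)) \<longlongrightarrow> M + A * 0) at_top"
      using \<gamma> by (intro tendsto_add tendsto_mult tendsto_const tendsto_neg_powr filterlim_ident) auto
    then show "((\<lambda>s. M + A * s powr (- \<gamma>)) \<longlongrightarrow> M) at_top"
      by simp
    show "\<forall>\<^sub>F s in at_top. 0 \<le> M + A * s powr (- \<gamma>)"
      using eventually_gt_at_top[of 0]
    proof eventually_elim
      case (elim s)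
      then show ?case using mM[of s] mA[of s] by linarith
    qed
  qed simp
  show ?thesis
  proof (cases "M = 0")
    case True
    then show ?thesis using integral_nonneg_AE[of "\<lambda>s. kern \<alpha> s * (M - m s)" lborel] nonneg by simp
  next
    case False
    then have M: "0 < M" using M0 by simp
    \<comment> \<open>the point where \<open>A s powr (- \<gamma>)\<close> equals \<open>M / 2\<close>\<close>
    define s0 where "s0 = (2 * A / M) powr (1 / \<gamma>)"
    have s0: "0 < s0" using A M by (simp add: s0_def)
    have half: "m s \<le> M / 2" if "s0 \<le> s" for s
    proof -
      have "m s \<le> A * s powr (- \<gamma>)" using mA[of s] s0 that by linarith
      also have "\<dots> \<le> A * s0 powr (- \<gamma>)"
        using s0 that A \<gamma> by (intro mult_left_mono powr_mono2') auto
      also have "s0 powr (- \<gamma>) = M / (2 * A)"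
        using A M \<gamma> by (simp add: s0_def powr_powr powr_minus_divide)
      finally show ?thesis using A by simp
    qed
    have "M powr (1 + \<alpha> / \<gamma>) / (2 * \<alpha> * (2 * A) powr (\<alpha> / \<gamma>)) = M / 2 * (s0 powr (- \<alpha>) / \<alpha>)"
    proof -
      have "s0 powr (- \<alpha>) = M powr (\<alpha> / \<gamma>) / (2 * A) powr (\<alpha> / \<gamma>)"
        using A M by (simp add: s0_def powr_powr powr_minus_divide powr_divide)
      then show ?thesis using M by (simp add: powr_add)
    qed
    also have "\<dots> = (\<integral>s. M / 2 * (indicator {s0..} s * s powr (- 1 - \<alpha>)) \<partial>lborel)"
      using powr_tail[OF \<alpha> s0] by (simp add: has_bochner_integral_iff)
    also have "\<dots> \<le> (\<integral>s. kern \<alpha> s * (M - m s) \<partial>lborel)"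
    proof (rule integral_mono[OF _ int])
      show "integrable lborel (\<lambda>s. M / 2 * (indicator {s0..} s * s powr (- 1 - \<alpha>)))"
        using powr_tail[OF \<alpha> s0] by (simp add: has_bochner_integral_iff)
      fix s
      show "M / 2 * (indicator {s0..} s * s powr (- 1 - \<alpha>)) \<le> kern \<alpha> s * (M - m s)"
      proof (cases "s0 \<le> s")
        case True
        have "M / 2 * s powr (- 1 - \<alpha>) \<le> (M - m s) * s powr (- 1 - \<alpha>)"
          using half[OF True] by (intro mult_right_mono) auto
        then show ?thesis using True s0 by (simp add: kern_def mult.commute)
      qed (simp add: nonneg)
    qed
    finally show ?thesis .
  qed
qed

text \<open>Here \<open>N\<close> stands for the norm of \<open>f\<close> and \<open>K\<close> for a constant independent of \<open>f\<close>. The bound on the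
  averages is only required for \<open>N > 0\<close>: when \<open>N = 0\<close> the left-hand side is zero, because division by
  zero yields zero.\<close>

lemma Lambda_lower_bound:
  fixes f :: "real^'n::finite \<Rightarrow> real"
  assumes f: "schwartz f" and \<alpha>: "0 < \<alpha>" "\<alpha> < 2" and \<gamma>: "0 < \<gamma>" and K: "0 < K" and N: "0 \<le> N"
    and max: "\<And>y. partial k f y \<le> partial k f x"
    and bound: "\<And>s. 0 < N \<Longrightarrow> 0 < s \<Longrightarrow> \<bar>gmean (partial k f) x s\<bar> \<le> K * N * s powr (- \<gamma>)"
  shows "partial k f x powr (1 + \<alpha> / \<gamma>) / ((heat_const \<alpha> * (2 * \<alpha> * (2 * K) powr (\<alpha> / \<gamma>))) * N powr (\<alpha> / \<gamma>))
     \<le> Lambda \<alpha> (partial k f) x"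
proof -
  have g: "schwartz (partial k f)" using f by (rule schwartz_partial)
  have hc: "0 < heat_const \<alpha>" by (rule heat_const_pos[OF \<alpha>])
  note le = gmean_le[OF g max]
  show ?thesis
  proof (cases "N = 0")
    case True
    have "0 \<le> (\<integral>s. kern \<alpha> s * (partial k f x - gmean (partial k f) x s) \<partial>lborel)"
      using le by (intro integral_nonneg_AE) (simp add: kern_nonneg)
    then have "0 \<le> Lambda \<alpha> (partial k f) x"
      unfolding Lambda_heat(2)[OF g \<alpha>, symmetric] using hc by (simp add: zero_le_mult_iff)
    then show ?thesis using True by simp
  next
    case False
    then have N: "0 < N" using N by simp
    have "partial k f x powr (1 + \<alpha> / \<gamma>) / (2 * \<alpha> * (2 * (K * N)) powr (\<alpha> / \<gamma>)) \<le> heat_const \<alpha> * Lambda \<alpha> (partial k f) x"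
      unfolding Lambda_heat(2)[OF g \<alpha>]
      using N K bound le by (intro kern_lower_bound \<alpha> \<gamma> Lambda_heat(1)[OF g \<alpha>]) auto
    also have "(2 * (K * N)) powr (\<alpha> / \<gamma>) = (2 * K) powr (\<alpha> / \<gamma>) * N powr (\<alpha> / \<gamma>)"
      using K N by (simp add: powr_mult flip: mult.assoc)
    finally have "partial k f x powr (1 + \<alpha> / \<gamma>) / (2 * \<alpha> * ((2 * K) powr (\<alpha> / \<gamma>) * N powr (\<alpha> / \<gamma>))) / heat_const \<alpha>
        \<le> heat_const \<alpha> * Lambda \<alpha> (partial k f) x / heat_const \<alpha>"
      using hc by (intro divide_right_mono) auto
    also have "\<dots> = Lambda \<alpha> (partial k f) x"
      using hc by simp
    finally show ?thesis
      by (simp only: divide_divide_eq_left mult.assoc mult.commute mult.left_commute)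
  qed
qed

section \<open>The Hoelder bound\<close>

lemma schwartz_lipschitz:
  fixes f :: "real^'n::finite \<Rightarrow> real"
  assumes f: "schwartz f"
  obtains L where "0 \<le> L" "\<And>x y. \<bar>f x - f y\<bar> \<le> L * norm (x - y)"
proof -
  have "\<exists>B. \<forall>y. \<bar>partial k f y\<bar> \<le> B" for k
    using schwartz_bounded[OF schwartz_partial[OF f, of k]] by metis
  then obtain B where B: "\<bar>partial k f y\<bar> \<le> B k" for k y by metis
  have "\<exists>D. \<forall>y. (f has_derivative D y) (at y)"
    using schwartz_differentiable[OF f] unfolding differentiable_on_def differentiable_def
    by (intro choice) simp
  then obtain D where D: "(f has_derivative D y) (at y)" for y by blast
  define L where "L = (\<Sum>k\<in>UNIV. B k)"
  have "norm (D y h) \<le> L * norm h" for y h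
  proof -
    have lin: "linear (D y)" using D by (rule has_derivative_linear)
    have "D y h = D y (\<Sum>k\<in>UNIV. (h $ k) *\<^sub>R axis k 1)"
      using basis_expansion[of h] by (simp add: scalar_mult_eq_scaleR)
    also have "\<dots> = (\<Sum>k\<in>UNIV. (h $ k) * partial k f y)"
      by (simp add: linear_sum[OF lin] linear_scale[OF lin] partial_eq_derivative[OF D])
    also have "norm \<dots> \<le> (\<Sum>k\<in>UNIV. norm h * B k)"
    proof (rule sum_norm_le)
      fix k
      show "norm (h $ k * partial k f y) \<le> norm h * B k"
        using component_le_norm_cart[of h k] B[of k y] by (simp add: abs_mult mult_mono)
    qed
    also have "\<dots> = L * norm h" by (simp add: L_def sum_distrib_left mult.commute)
    finally show ?thesis .
  qed
  then have "onorm (D y) \<le> L" for y by (rule onorm_le)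
  then have "\<bar>f x - f y\<bar> \<le> L * norm (x - y)" for x y
    using differentiable_bound[OF convex_UNIV, of f D L x y] D by simp
  moreover have "0 \<le> L"
    unfolding L_def using B by (intro sum_nonneg) (meson abs_ge_zero order_trans)
  ultimately show ?thesis using that by blast
qed

text \<open>Boundedness is what makes the real-valued supremum in the Hoelder norm an upper bound: for points at
  distance at most one it comes from the Lipschitz constant, for others from the bound on \<open>\<bar>f\<bar>\<close>.\<close>

lemma holder_quotient_bdd:
  fixes f :: "real^'n::finite \<Rightarrow> real"
  assumes f: "schwartz f" and \<delta>: "0 < \<delta>" "\<delta> < 1"
  shows "bdd_above ((\<lambda>(x, y). \<bar>f x - f y\<bar> / norm (x - y) powr \<delta>) ` {(x, y). x \<noteq> y})"
proof -
  obtain L where L: "0 \<le> L" "\<And>x y. \<bar>f x - f y\<bar> \<le> L * norm (x - y)" using schwartz_lipschitz[OF f] by blast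
  obtain B where B: "0 < B" "\<And>x. \<bar>f x\<bar> \<le> B" using schwartz_bounded[OF f] by blast
  have "\<bar>f x - f y\<bar> / norm (x - y) powr \<delta> \<le> L + 2 * B" if "x \<noteq> y" for x y
  proof -
    define r where "r = norm (x - y)"
    have r: "0 < r" using that by (simp add: r_def)
    have "\<bar>f x - f y\<bar> \<le> (L + 2 * B) * r powr \<delta>"
    proof (cases "r \<le> 1")
      case True
      have "r powr 1 \<le> r powr \<delta>" using r True \<delta> by (intro powr_mono') auto
      then have "r \<le> r powr \<delta>" using r by simp
      then have "L * r \<le> (L + 2 * B) * r powr \<delta>" using L B r by (intro mult_mono) auto
      then show ?thesis using L(2)[of x y] by (simp add: r_def)
    next
      case False
      then have "1 \<le> r powr \<delta>" using \<delta> by (intro ge_one_powr_ge_zero) auto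
      then have "2 * B * 1 \<le> (L + 2 * B) * r powr \<delta>" using L B by (intro mult_mono) auto
      moreover have "\<bar>f x - f y\<bar> \<le> 2 * B" using B(2)[of x] B(2)[of y] by linarith
      ultimately show ?thesis by linarith
    qed
    then show ?thesis using r by (simp add: pos_divide_le_eq r_def)
  qed
  then show ?thesis by (intro bdd_aboveI[of _ "L + 2 * B"]) auto
qed

lemma Linf_norm_nonneg:
  fixes f :: "real^'n::finite \<Rightarrow> real"
  shows "0 \<le> Linf_norm f"
proof -
  have "esssup (lborel :: (real^'n) measure) (\<lambda>x. 0 :: ereal) \<le> esssup lborel (\<lambda>x. ereal \<bar>f x\<bar>)"
    by (rule esssup_mono) auto
  then have "0 \<le> esssup lborel (\<lambda>x. ereal \<bar>f x\<bar>)"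
    by (subst (asm) esssup_const) auto
  then show ?thesis unfolding Linf_norm_def by (rule real_of_ereal_pos)
qed

lemma
  fixes f :: "real^'n::finite \<Rightarrow> real"
  assumes f: "schwartz f" and \<delta>: "0 < \<delta>" "\<delta> < 1"
  shows holder_norm_bound: "\<bar>f x - f y\<bar> \<le> holder_norm \<delta> f * norm (x - y) powr \<delta>"
    and holder_norm_nonneg: "0 \<le> holder_norm \<delta> f"
proof -
  have q: "\<bar>f x - f y\<bar> / norm (x - y) powr \<delta> \<le> holder_norm \<delta> f" if "x \<noteq> y" for x y
  proof -
    have "\<bar>f x - f y\<bar> / norm (x - y) powr \<delta> \<le> (SUP (x, y)\<in>{(x, y). x \<noteq> y}. \<bar>f x - f y\<bar> / norm (x - y) powr \<delta>)"
      using cSUP_upper[OF _ holder_quotient_bdd[OF f \<delta>], of "(x, y)"] that by simp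
    then show ?thesis unfolding holder_norm_def using Linf_norm_nonneg[of f] by linarith
  qed
  have "axis undefined 1 \<noteq> (0 :: real^'n)" by (simp add: axis_eq_0_iff)
  from q[OF this] show "0 \<le> holder_norm \<delta> f"
    by (rule order.trans[rotated]) simp
  show "\<bar>f x - f y\<bar> \<le> holder_norm \<delta> f * norm (x - y) powr \<delta>"
    using q[of x y] by (cases "x = y") (simp_all add: pos_divide_le_eq)
qed

text \<open>The summand \<open>1\<close> in the constant serves only to make its positivity immediate.\<close>

lemma gmean_partial_holder:
  fixes f :: "real^'n::finite \<Rightarrow> real"
  assumes f: "schwartz f" and \<delta>: "0 < \<delta>" "\<delta> < 1" and s: "0 < s"
  shows "\<bar>gmean (partial k f) x s\<bar>
    \<le> (1 + (\<integral>z. norm (z::real^'n) powr (1 + \<delta>) * gauss z \<partial>lborel)) * holder_norm \<delta> f * s powr (- (1 - \<delta>))"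
proof -
  let ?H = "holder_norm \<delta> f" and ?I = "\<integral>z. norm (z::real^'n) powr (1 + \<delta>) * gauss z \<partial>lborel"
  have "\<bar>norm z powr (1 + \<delta>)\<bar> \<le> 1 * (1 + (norm z)\<^sup>2)" for z :: "real^'n"
    using powr_le_one_plus_sq[of "norm z" "1 + \<delta>"] \<delta> by simp
  then have int: "integrable lborel (\<lambda>z::real^'n. norm z powr (1 + \<delta>) * gauss z)"
    by (rule gauss_moment_integrable) measurable
  have "\<bar>gmean (partial k f) x s\<bar> \<le> (\<integral>z. (?H * s powr \<delta>) * (norm z powr (1 + \<delta>) * gauss (z::real^'n)) \<partial>lborel) / s"
  proof (rule gmean_partial_bound[OF f s, where a="f x"])
    show "integrable lborel (\<lambda>z::real^'n. (?H * s powr \<delta>) * (norm z powr (1 + \<delta>) * gauss z))"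
      by (intro integrable_mult_right int)
    fix z :: "real^'n"
    have "\<bar>f (x + s *\<^sub>R z) - f x\<bar> \<le> ?H * (s powr \<delta> * norm z powr \<delta>)"
      using holder_norm_bound[OF f \<delta>, of "x + s *\<^sub>R z" x] s by (simp add: powr_mult)
    then have "norm z * \<bar>f (x + s *\<^sub>R z) - f x\<bar> * gauss z \<le> norm z * (?H * (s powr \<delta> * norm z powr \<delta>)) * gauss z"
      by (intro mult_right_mono mult_left_mono less_imp_le[OF gauss_pos]) auto
    also have "\<dots> = (?H * s powr \<delta>) * (norm z powr (1 + \<delta>) * gauss z)"
      by (simp add: powr_add)
    finally show "norm z * \<bar>f (x + s *\<^sub>R z) - f x\<bar> * gauss z \<le> (?H * s powr \<delta>) * (norm z powr (1 + \<delta>) * gauss z)" .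
  qed
  also have "\<dots> = (?H * s powr \<delta>) * ?I / s" by (simp only: integral_mult_right_zero)
  also have "\<dots> = ?I * (?H * s powr (- (1 - \<delta>)))"
    using s by (simp add: powr_diff)
  also have "\<dots> \<le> (1 + ?I) * (?H * s powr (- (1 - \<delta>)))"
    using holder_norm_nonneg[OF f \<delta>] by (intro mult_right_mono) auto
  finally show ?thesis by (simp only: mult.assoc)
qed

section \<open>The Lebesgue norm bound\<close>

lemma Lp_integrable:
  fixes f :: "real^'n::finite \<Rightarrow> real"
  assumes f: "schwartz f" and p: "1 \<le> p"
  shows "integrable lborel (\<lambda>x. \<bar>f x\<bar> powr p)"
proof -
  note [measurable] = schwartz_measurable[OF f]
  obtain C where C: "0 < C" "\<And>x. \<bar>f x\<bar> \<le> C * weight x" using schwartz_bound[OF f] by blast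
  show ?thesis
  proof (rule Bochner_Integration.integrable_bound[where f="\<lambda>x. C powr p * weight x"])
    show "integrable lborel (\<lambda>x::real^'n. C powr p * weight x)"
      by (intro integrable_mult_right weight_integrable)
    show "AE x in lborel. norm (\<bar>f x\<bar> powr p) \<le> norm (C powr p * weight x)"
    proof (rule AE_I2)
      fix x
      have "\<bar>f x\<bar> powr p \<le> (C * weight x) powr p" using C p by (intro powr_mono2) auto
      also have "\<dots> = C powr p * weight x powr p" using C weight_pos[of x] by (simp add: powr_mult)
      also have "\<dots> \<le> C powr p * weight x powr 1"
        using weight_pos[of x] weight_le_1[of x] p by (intro mult_left_mono powr_mono') auto
      finally show "norm (\<bar>f x\<bar> powr p) \<le> norm (C powr p * weight x)"
        using weight_pos[of x] by simp
    qed
  qed measurable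
qed

text \<open>A weighted Young inequality. Applied with \<open>a = \<bar>f\<bar>\<close> it plays the part of Hoelder's inequality,
  and it treats \<open>p = 1\<close> and \<open>p > 1\<close> uniformly.\<close>

lemma young_powr:
  assumes "0 \<le> (a::real)" "0 < \<epsilon>" "1 \<le> p"
  shows "a \<le> \<epsilon> + \<epsilon> powr (1 - p) * a powr p"
proof (cases "a \<le> \<epsilon>")
  case False
  then have a: "\<epsilon> < a" "0 < a" using assms by auto
  have "a = a powr (1 - p) * a powr p" using a by (simp flip: powr_add)
  also have "\<dots> \<le> \<epsilon> powr (1 - p) * a powr p"
    using a assms by (intro mult_right_mono powr_mono2') auto
  finally show ?thesis using assms by linarith
qed (use assms in \<open>simp add: add_increasing2\<close>)

lemma gmean_partial_Lp:
  obtains K where "0 < K"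
    "\<And>(k::'n::finite) f x s p. schwartz f \<Longrightarrow> 1 \<le> p \<Longrightarrow> 0 < Lp_norm p f \<Longrightarrow> 0 < s \<Longrightarrow>
       \<bar>gmean (partial k f) x s\<bar> \<le> K * Lp_norm p f * s powr (- (1 + real CARD('n) / p))"
proof -
  obtain C where C: "0 < C" "\<And>z::real^'n. (1 + (norm z)\<^sup>2) * gauss z \<le> C * weight z"
    using gauss_moment_bound by blast
  have sup: "norm z * gauss z \<le> C" for z :: "real^'n"
  proof -
    have "norm z * gauss z \<le> (1 + (norm z)\<^sup>2) * gauss z"
      by (intro mult_right_mono norm_le_one_plus_sq less_imp_le[OF gauss_pos])
    also have "\<dots> \<le> C * weight z" by (rule C(2))
    also have "\<dots> \<le> C * 1" using C(1) weight_le_1 by (intro mult_left_mono) auto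
    finally show ?thesis by simp
  qed
  have int: "integrable lborel (\<lambda>z::real^'n. norm z * gauss z)"
    by (rule gauss_moment_integrable[where B=1]) (use norm_le_one_plus_sq in auto)
  define I where "I = (\<integral>z. norm (z::real^'n) * gauss z \<partial>lborel)"
  have I: "0 \<le> I" unfolding I_def by (intro integral_nonneg_AE) (simp add: less_imp_le[OF gauss_pos])
  show ?thesis
  proof
    show "0 < I + C" using I C(1) by simp
    fix k :: 'n and f :: "real^'n \<Rightarrow> real" and x s p
    assume f: "schwartz f" and p: "1 \<le> (p::real)" and N0: "0 < Lp_norm p f" and s: "0 < (s::real)"
    note [measurable] = schwartz_measurable[OF f]
    define N where "N = Lp_norm p f"
    define J where "J = (\<integral>x. \<bar>f x\<bar> powr p \<partial>lborel)"
    have N: "0 < N" using N0 by (simp add: N_def)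
    have "0 \<le> J" unfolding J_def by (intro integral_nonneg_AE) simp
    then have NJ: "N powr p = J" using p by (simp add: N_def Lp_norm_def J_def powr_powr)
    \<comment> \<open>the value of \<open>\<epsilon>\<close> for which both terms of Young's inequality scale in the same way\<close>
    define \<epsilon> where "\<epsilon> = s powr (- (real CARD('n) / p)) * N"
    have \<epsilon>: "0 < \<epsilon>" using s N by (simp add: \<epsilon>_def)
    have "\<epsilon> powr p = s powr (- real CARD('n)) * J"
      using s N p by (simp add: \<epsilon>_def powr_mult powr_powr NJ)
    also have "s powr (- real CARD('n)) = 1 / s ^ CARD('n)"
      using s by (simp add: powr_minus_divide powr_realpow)
    finally have \<epsilon>p: "\<epsilon> powr p = J / s ^ CARD('n)" by simp
    have fint: "integrable lborel (\<lambda>z. \<bar>f (x + s *\<^sub>R z)\<bar> powr p)"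
      using integrable_affine[OF Lp_integrable[OF f p], of s x] s by simp
    have fJ: "(\<integral>z. \<bar>f (x + s *\<^sub>R z)\<bar> powr p \<partial>lborel) = J / s ^ CARD('n)"
      using integral_affine[of "\<lambda>z. \<bar>f z\<bar> powr p" s x] s by (simp add: J_def divide_inverse mult.commute)
    define h where "h = (\<lambda>z::real^'n. \<epsilon> * (norm z * gauss z) + (\<epsilon> powr (1 - p) * C) * \<bar>f (x + s *\<^sub>R z)\<bar> powr p)"
    have "\<bar>gmean (partial k f) x s\<bar> \<le> (\<integral>z. h z \<partial>lborel) / s"
    proof (rule gmean_partial_bound[OF f s, where a=0])
      show "integrable lborel h" unfolding h_def
        by (intro Bochner_Integration.integrable_add integrable_mult_right int fint)
      fix z :: "real^'n"
      define w where "w = norm z * gauss z"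
      have w: "0 \<le> w" "w \<le> C" using sup gauss_pos[of z] by (auto simp: w_def)
      have "norm z * \<bar>f (x + s *\<^sub>R z) - 0\<bar> * gauss z = w * \<bar>f (x + s *\<^sub>R z)\<bar>" by (simp add: w_def)
      also have "\<dots> \<le> w * (\<epsilon> + \<epsilon> powr (1 - p) * \<bar>f (x + s *\<^sub>R z)\<bar> powr p)"
        using w \<epsilon> p by (intro mult_left_mono young_powr) auto
      also have "\<dots> = \<epsilon> * w + (\<epsilon> powr (1 - p) * w) * \<bar>f (x + s *\<^sub>R z)\<bar> powr p"
        by (simp add: algebra_simps)
      also have "\<dots> \<le> h z"
        unfolding h_def w_def[symmetric] using w by (intro add_left_mono mult_right_mono mult_left_mono) auto
      finally show "norm z * \<bar>f (x + s *\<^sub>R z) - 0\<bar> * gauss z \<le> h z" .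
    qed
    also have "(\<integral>z. h z \<partial>lborel) = \<epsilon> * I + \<epsilon> powr (1 - p) * C * (J / s ^ CARD('n))"
      unfolding h_def I_def fJ[symmetric]
      by (subst Bochner_Integration.integral_add) (simp_all add: int fint)
    also have "\<dots> = \<epsilon> * (I + C)"
    proof -
      have "\<epsilon> powr (1 - p) * \<epsilon> powr p = \<epsilon>" using \<epsilon> by (simp flip: powr_add)
      then show ?thesis unfolding \<epsilon>p[symmetric] by (simp add: algebra_simps)
    qed
    also have "\<epsilon> * (I + C) / s = (I + C) * N * s powr (- (1 + real CARD('n) / p))"
      using s by (simp add: \<epsilon>_def powr_diff powr_minus_divide powr_add mult.commute)
    finally show "\<bar>gmean (partial k f) x s\<bar> \<le> (I + C) * Lp_norm p f * s powr (- (1 + real CARD('n) / p))"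
      by (simp only: N_def)
  qed
qed

section \<open>The two inequalities\<close>

theorem theorem2p2:
  fixes \<alpha> :: real
  assumes "0 < \<alpha>" and "\<alpha> < 2"
  shows
    "(\<forall>\<delta>. 0 < \<delta> \<and> \<delta> < 1 \<longrightarrow>
       (\<exists>c>0. \<forall>(f :: real^'n::finite \<Rightarrow> real) (k :: 'n) (xbar :: real^'n).
          schwartz f \<and> f \<noteq> (\<lambda>_. 0) \<and> (\<forall>x. partial k f x \<le> partial k f xbar) \<longrightarrow>
          Lambda \<alpha> (partial k f) xbar \<ge>
            partial k f xbar powr (1 + \<alpha> / (1 - \<delta>)) /
            (c * holder_norm \<delta> f powr (\<alpha> / (1 - \<delta>)))))
     \<and>
     (\<forall>p. 1 \<le> p \<longrightarrow>
       (\<exists>c>0. \<forall>(f :: real^'n::finite \<Rightarrow> real) (k :: 'n) (xbar :: real^'n).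
          schwartz f \<and> f \<noteq> (\<lambda>_. 0) \<and> (\<forall>x. partial k f x \<le> partial k f xbar) \<longrightarrow>
          Lambda \<alpha> (partial k f) xbar \<ge>
            partial k f xbar powr (1 + \<alpha> * p / (real CARD('n) + p)) /
            (c * Lp_norm p f powr (\<alpha> * p / (real CARD('n) + p)))))"
proof (intro conjI allI impI)
  fix \<delta> :: real assume "0 < \<delta> \<and> \<delta> < 1"
  then have \<delta>: "0 < \<delta>" "\<delta> < 1" by auto
  define K where "K = 1 + (\<integral>z. norm (z::real^'n) powr (1 + \<delta>) * gauss z \<partial>lborel)"
  have "0 \<le> (\<integral>z. norm (z::real^'n) powr (1 + \<delta>) * gauss z \<partial>lborel)"
    by (intro integral_nonneg_AE) (simp add: less_imp_le[OF gauss_pos])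
  then have K: "0 < K" unfolding K_def by linarith
  show "\<exists>c>0. \<forall>(f :: real^'n \<Rightarrow> real) (k :: 'n) (xbar :: real^'n).
          schwartz f \<and> f \<noteq> (\<lambda>_. 0) \<and> (\<forall>x. partial k f x \<le> partial k f xbar) \<longrightarrow>
          Lambda \<alpha> (partial k f) xbar \<ge>
            partial k f xbar powr (1 + \<alpha> / (1 - \<delta>)) /
            (c * holder_norm \<delta> f powr (\<alpha> / (1 - \<delta>)))"
  proof (intro exI[of _ "heat_const \<alpha> * (2 * \<alpha> * (2 * K) powr (\<alpha> / (1 - \<delta>)))"] conjI allI impI)
    show "0 < heat_const \<alpha> * (2 * \<alpha> * (2 * K) powr (\<alpha> / (1 - \<delta>)))"
      using heat_const_pos[OF assms] assms K by simp
  next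
    fix f :: "real^'n \<Rightarrow> real" and k :: 'n and xbar :: "real^'n"
    assume "schwartz f \<and> f \<noteq> (\<lambda>_. 0) \<and> (\<forall>x. partial k f x \<le> partial k f xbar)"
    then have f: "schwartz f" and max: "partial k f x \<le> partial k f xbar" for x by auto
    show "Lambda \<alpha> (partial k f) xbar \<ge> partial k f xbar powr (1 + \<alpha> / (1 - \<delta>)) /
            (heat_const \<alpha> * (2 * \<alpha> * (2 * K) powr (\<alpha> / (1 - \<delta>))) * holder_norm \<delta> f powr (\<alpha> / (1 - \<delta>)))"
      using \<delta> by (intro Lambda_lower_bound f assms K holder_norm_nonneg max)
        (auto simp only: K_def diff_gt_0_iff_gt intro!: gmean_partial_holder[OF f \<delta>])
  qed
next
  fix p :: real assume p: "1 \<le> p"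
  obtain K where K: "0 < K"
    "\<And>(k :: 'n) f x s p. schwartz f \<Longrightarrow> 1 \<le> p \<Longrightarrow> 0 < Lp_norm p f \<Longrightarrow> 0 < s \<Longrightarrow>
       \<bar>gmean (partial k f) x s\<bar> \<le> K * Lp_norm p f * s powr (- (1 + real CARD('n) / p))"
    using gmean_partial_Lp by metis
  have exponent: "\<alpha> * p / (real CARD('n) + p) = \<alpha> / (1 + real CARD('n) / p)"
    using p by (simp add: field_simps)
  show "\<exists>c>0. \<forall>(f :: real^'n \<Rightarrow> real) (k :: 'n) (xbar :: real^'n).
          schwartz f \<and> f \<noteq> (\<lambda>_. 0) \<and> (\<forall>x. partial k f x \<le> partial k f xbar) \<longrightarrow>
          Lambda \<alpha> (partial k f) xbar \<ge>
            partial k f xbar powr (1 + \<alpha> * p / (real CARD('n) + p)) /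
            (c * Lp_norm p f powr (\<alpha> * p / (real CARD('n) + p)))"
    unfolding exponent
  proof (intro exI[of _ "heat_const \<alpha> * (2 * \<alpha> * (2 * K) powr (\<alpha> / (1 + real CARD('n) / p)))"] conjI allI impI)
    show "0 < heat_const \<alpha> * (2 * \<alpha> * (2 * K) powr (\<alpha> / (1 + real CARD('n) / p)))"
      using heat_const_pos[OF assms] assms K by simp
  next
    fix f :: "real^'n \<Rightarrow> real" and k :: 'n and xbar :: "real^'n"
    assume "schwartz f \<and> f \<noteq> (\<lambda>_. 0) \<and> (\<forall>x. partial k f x \<le> partial k f xbar)"
    then have f: "schwartz f" and max: "partial k f x \<le> partial k f xbar" for x by auto
    have \<gamma>: "0 < 1 + real CARD('n) / p" using p by (simp add: add_pos_nonneg)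
    have N: "0 \<le> Lp_norm p f" by (simp add: Lp_norm_def)
    show "Lambda \<alpha> (partial k f) xbar \<ge> partial k f xbar powr (1 + \<alpha> / (1 + real CARD('n) / p)) /
            (heat_const \<alpha> * (2 * \<alpha> * (2 * K) powr (\<alpha> / (1 + real CARD('n) / p))) * Lp_norm p f powr (\<alpha> / (1 + real CARD('n) / p)))"
      by (rule Lambda_lower_bound[OF f assms \<gamma> K(1) N max K(2)[OF f p]])
  qed
qed

end
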